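(* Let $\perp$ be an invariant relation satisfying left and right monotonicity such that: (1) $\perp^{da}\to\perp$; (2) $\perp$ satisfies $\perp^h$-amalgamation over models; (3) $\perp^M$ satisfies extension. Then $\perp^M=\perp^f=\perp^{da}$.
   Context: Work in a monster model of a complete first-order theory; $A,B,C,D$ denote small subsets (or tuples), $AB$ means $A\cup B$, and $A\equiv_C A'$ means equality of types over $C$. $\perp$ denotes a ternary relation $A\perp_C B$ on small subsets. It is invariant if $A\perp_C B$ and $ABC\equiv A'B'C'$ imply $A'\perp_{C'}B'$. Write $\perp^0\to\perp$ if $A\perp^0_C B$ implies $A\perp_C B$ for all $A,B,C$. Right monotonicity: $A\perp_C BD$ implies $A\perp_C B$. Left monotonicity: $AD\perp_C B$ implies $A\perp_C B$. Extension: if $A\perp_C B$ then for every small $D\supseteq B$ there is $A'\equiv_{BC}A$ with $A'\perp_C D$. $\perp^M$ is defined by: $A\perp^M_C B$ iff $A\perp_D B$ for all $D$ with $C\subseteq D\subseteq \mathrm{acl}(BC)$. $A\perp^d_C B$ (resp. $A\perp^f_C B$) means that $\mathrm{tp}(A/BC)$ does not divide (resp. fork) over $C$. $A\perp^{da}_C B$ means $A\perp^d_C\mathrm{acl}(BC)$. $A\perp^h_C B$ means that $\mathrm{tp}(A/BC)$ is a coheir of $\mathrm{tp}(A/C)$, i.e. is finitely satisfiable in $C$. $\perp$ satisfies $\perp^h$-amalgamation over models if for every small model $M$ and small tuples $a,b,c_1,c_2$: if $c_1\equiv_M c_2$, $c_1\perp_M a$, $c_2\perp_M b$ and $a\perp^h_M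 b$, then there is $c$ with $c\perp_M ab$, $c\equiv_{Ma}c_1$ and $c\equiv_{Mb}c_2$. *)

theory Defs
  imports Main
begin

unbundle cardinal_syntax

section \<open>First-order structures\<close>

text \<open>
  Variables are de Bruijn indices. In \<open>sat S U e \<phi>\<close> the list \<open>e\<close> interprets the free variables
  \<open>0, \<dots>, length e - 1\<close>, so \<open>sat S U (xs @ bs) \<phi>\<close> is the satisfaction of \<open>\<phi>(x, b)\<close>.
\<close>

datatype 'f tm = Var nat | App 'f "'f tm list"

datatype ('f, 'r) fm =
    Equal "'f tm" "'f tm"
  | Rel 'r "'f tm list"
  | Neg "('f, 'r) fm"
  | And "('f, 'r) fm" "('f, 'r) fm"
  | Ex "('f, 'r) fm"

text \<open>
  The symbols of the language are the elements of \<open>funs\<close> and \<open>rels\<close> (either may be empty; constants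
  are nullary functions). The universe is the whole type \<open>'m\<close>. Interpretations are only relevant on
  symbols of the language and on argument lists of the right length.
\<close>

record ('f, 'r, 'm) struct =
  funs :: "'f set"
  rels :: "'r set"
  fun_ar :: "'f \<Rightarrow> nat"
  rel_ar :: "'r \<Rightarrow> nat"
  fun_int :: "'f \<Rightarrow> 'm list \<Rightarrow> 'm"
  rel_int :: "'r \<Rightarrow> 'm list \<Rightarrow> bool"

fun wf_tm :: "('f, 'r, 'm) struct \<Rightarrow> nat \<Rightarrow> 'f tm \<Rightarrow> bool" where
  "wf_tm S n (Var k) \<longleftrightarrow> k < n"
| "wf_tm S n (App f ts) \<longleftrightarrow> f \<in> funs S \<and> length ts = fun_ar S f \<and> (\<forall>t \<in> set ts. wf_tm S n t)"

fun wf_fm :: "('f, 'r, 'm) struct \<Rightarrow> nat \<Rightarrow> ('f, 'r) fm \<Rightarrow> bool" where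
  "wf_fm S n (Equal t u) \<longleftrightarrow> wf_tm S n t \<and> wf_tm S n u"
| "wf_fm S n (Rel r ts) \<longleftrightarrow> r \<in> rels S \<and> length ts = rel_ar S r \<and> (\<forall>t \<in> set ts. wf_tm S n t)"
| "wf_fm S n (Neg \<phi>) \<longleftrightarrow> wf_fm S n \<phi>"
| "wf_fm S n (And \<phi> \<psi>) \<longleftrightarrow> wf_fm S n \<phi> \<and> wf_fm S n \<psi>"
| "wf_fm S n (Ex \<phi>) \<longleftrightarrow> wf_fm S (Suc n) \<phi>"

fun eval :: "('f, 'r, 'm) struct \<Rightarrow> 'm list \<Rightarrow> 'f tm \<Rightarrow> 'm" where
  "eval S e (Var k) = e ! k"
| "eval S e (App f ts) = fun_int S f (map (eval S e) ts)"

text \<open>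
  The quantifiers range over \<open>U\<close>: this is \<open>UNIV\<close> for satisfaction in \<open>S\<close> itself, and the underlying
  set of a substructure for satisfaction in that substructure.
\<close>

fun sat :: "('f, 'r, 'm) struct \<Rightarrow> 'm set \<Rightarrow> 'm list \<Rightarrow> ('f, 'r) fm \<Rightarrow> bool" where
  "sat S U e (Equal t u) \<longleftrightarrow> eval S e t = eval S e u"
| "sat S U e (Rel r ts) \<longleftrightarrow> rel_int S r (map (eval S e) ts)"
| "sat S U e (Neg \<phi>) \<longleftrightarrow> \<not> sat S U e \<phi>"
| "sat S U e (And \<phi> \<psi>) \<longleftrightarrow> sat S U e \<phi> \<and> sat S U e \<psi>"
| "sat S U e (Ex \<phi>) \<longleftrightarrow> (\<exists>m \<in> U. sat S U (m # e) \<phi>)"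

abbreviation holds :: "('f, 'r, 'm) struct \<Rightarrow> 'm list \<Rightarrow> ('f, 'r) fm \<Rightarrow> bool" where
  "holds S e \<phi> \<equiv> sat S UNIV e \<phi>"

definition elem_substruct :: "('f, 'r, 'm) struct \<Rightarrow> 'm set \<Rightarrow> bool" where
  "elem_substruct S M \<longleftrightarrow>
     M \<noteq> {} \<and>
     (\<forall>f \<in> funs S. \<forall>xs. length xs = fun_ar S f \<and> set xs \<subseteq> M \<longrightarrow> fun_int S f xs \<in> M) \<and>
     (\<forall>e \<phi>. set e \<subseteq> M \<and> wf_fm S (length e) \<phi> \<longrightarrow> (sat S M e \<phi> \<longleftrightarrow> holds S e \<phi>))"

definition automorphism :: "('f, 'r, 'm) struct \<Rightarrow> ('m \<Rightarrow> 'm) \<Rightarrow> bool" where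
  "automorphism S \<sigma> \<longleftrightarrow>
     bij \<sigma> \<and>
     (\<forall>f \<in> funs S. \<forall>xs. length xs = fun_ar S f \<longrightarrow>
        \<sigma> (fun_int S f xs) = fun_int S f (map \<sigma> xs)) \<and>
     (\<forall>r \<in> rels S. \<forall>xs. length xs = rel_ar S r \<longrightarrow>
        (rel_int S r (map \<sigma> xs) \<longleftrightarrow> rel_int S r xs))"


section \<open>Types\<close>

text \<open>Equality of types over \<open>C\<close>, for finite tuples and for tuples indexed by an arbitrary set \<open>I\<close>.\<close>

definition list_tp_eq :: "('f, 'r, 'm) struct \<Rightarrow> 'm set \<Rightarrow> 'm list \<Rightarrow> 'm list \<Rightarrow> bool" where
  "list_tp_eq S C xs ys \<longleftrightarrow>
     length xs = length ys \<and>
     (\<forall>\<phi> cs. set cs \<subseteq> C \<and> wf_fm S (length xs + length cs) \<phi> \<longrightarrow>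
        (holds S (xs @ cs) \<phi> \<longleftrightarrow> holds S (ys @ cs) \<phi>))"

definition tp_eq ::
  "('f, 'r, 'm) struct \<Rightarrow> 'm set \<Rightarrow> 'i set \<Rightarrow> ('i \<Rightarrow> 'm) \<Rightarrow> ('i \<Rightarrow> 'm) \<Rightarrow> bool" where
  "tp_eq S C I a a' \<longleftrightarrow> (\<forall>is. set is \<subseteq> I \<longrightarrow> list_tp_eq S C (map a is) (map a' is))"

text \<open>
  A set \<open>A\<close> is regarded as a tuple by letting it enumerate itself. The realizations of \<open>tp(A/C)\<close>
  are then the restrictions to \<open>A\<close> of maps \<open>f\<close> with \<open>realizes S C A f\<close>, and \<open>A \<equiv>\<^sub>C A'\<close> is
  witnessed by such an \<open>f\<close> with \<open>A' = f ` A\<close>.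
\<close>

abbreviation realizes :: "('f, 'r, 'm) struct \<Rightarrow> 'm set \<Rightarrow> 'm set \<Rightarrow> ('m \<Rightarrow> 'm) \<Rightarrow> bool" where
  "realizes S C A f \<equiv> tp_eq S C A (\<lambda>x. x) f"

definition acl :: "('f, 'r, 'm) struct \<Rightarrow> 'm set \<Rightarrow> 'm set" where
  "acl S A = {m. \<exists>\<phi> as. set as \<subseteq> A \<and> wf_fm S (Suc (length as)) \<phi> \<and>
                   holds S (m # as) \<phi> \<and> finite {x. holds S (x # as) \<phi>}}"


section \<open>Monster models\<close>

definition small :: "'k rel \<Rightarrow> 'a set \<Rightarrow> bool" where
  "small \<kappa> A \<longleftrightarrow> |A| <o \<kappa>"

definition saturated :: "('f, 'r, 'm) struct \<Rightarrow> 'k rel \<Rightarrow> bool" where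
  "saturated S \<kappa> \<longleftrightarrow>
     (\<forall>B p. small \<kappa> B \<and>
        (\<forall>(\<phi>, bs) \<in> p. wf_fm S (Suc (length bs)) \<phi> \<and> set bs \<subseteq> B) \<and>
        (\<forall>q \<subseteq> p. finite q \<longrightarrow> (\<exists>x. \<forall>(\<phi>, bs) \<in> q. holds S (x # bs) \<phi>)) \<longrightarrow>
        (\<exists>x. \<forall>(\<phi>, bs) \<in> p. holds S (x # bs) \<phi>))"

definition strongly_homogeneous :: "('f, 'r, 'm) struct \<Rightarrow> 'k rel \<Rightarrow> bool" where
  "strongly_homogeneous S \<kappa> \<longleftrightarrow>
     (\<forall>A f. small \<kappa> A \<and> realizes S {} A f \<longrightarrow>
        (\<exists>\<sigma>. automorphism S \<sigma> \<and> (\<forall>a \<in> A. \<sigma> a = f a)))"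

text \<open>
  The ambient complete theory is the theory of \<open>S\<close>. The cardinal \<open>\<kappa>\<close>, below which sets are called
  small, is any uncountable cardinal larger than the language.
\<close>

definition monster :: "('f, 'r, 'm) struct \<Rightarrow> 'k rel \<Rightarrow> bool" where
  "monster S \<kappa> \<longleftrightarrow>
     Card_order \<kappa> \<and> natLeq <o \<kappa> \<and> |funs S| <o \<kappa> \<and> |rels S| <o \<kappa> \<and>
     saturated S \<kappa> \<and> strongly_homogeneous S \<kappa>"

definition small_model :: "('f, 'r, 'm) struct \<Rightarrow> 'k rel \<Rightarrow> 'm set \<Rightarrow> bool" where
  "small_model S \<kappa> M \<longleftrightarrow> small \<kappa> M \<and> elem_substruct S M"


section \<open>Ternary relations\<close>

text \<open>\<open>R A C B\<close> stands for \<open>A \<perp>\<^sub>C B\<close>. Only its values on small sets matter.\<close>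

type_synonym 'm ternary = "'m set \<Rightarrow> 'm set \<Rightarrow> 'm set \<Rightarrow> bool"

definition rel_implies :: "'k rel \<Rightarrow> 'm ternary \<Rightarrow> 'm ternary \<Rightarrow> bool" where
  "rel_implies \<kappa> R0 R \<longleftrightarrow>
     (\<forall>A B C. small \<kappa> A \<and> small \<kappa> B \<and> small \<kappa> C \<and> R0 A C B \<longrightarrow> R A C B)"

definition invariant :: "('f, 'r, 'm) struct \<Rightarrow> 'k rel \<Rightarrow> 'm ternary \<Rightarrow> bool" where
  "invariant S \<kappa> R \<longleftrightarrow>
     (\<forall>A B C f. small \<kappa> A \<and> small \<kappa> B \<and> small \<kappa> C \<and>
        R A C B \<and> realizes S {} (A \<union> B \<union> C) f \<longrightarrow> R (f ` A) (f ` C) (f ` B))"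

definition right_monotone :: "'k rel \<Rightarrow> 'm ternary \<Rightarrow> bool" where
  "right_monotone \<kappa> R \<longleftrightarrow>
     (\<forall>A B C D. small \<kappa> A \<and> small \<kappa> B \<and> small \<kappa> C \<and> small \<kappa> D \<and>
        R A C (B \<union> D) \<longrightarrow> R A C B)"

definition left_monotone :: "'k rel \<Rightarrow> 'm ternary \<Rightarrow> bool" where
  "left_monotone \<kappa> R \<longleftrightarrow>
     (\<forall>A B C D. small \<kappa> A \<and> small \<kappa> B \<and> small \<kappa> C \<and> small \<kappa> D \<and>
        R (A \<union> D) C B \<longrightarrow> R A C B)"

definition extension :: "('f, 'r, 'm) struct \<Rightarrow> 'k rel \<Rightarrow> 'm ternary \<Rightarrow> bool" where
  "extension S \<kappa> R \<longleftrightarrow>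
     (\<forall>A B C D. small \<kappa> A \<and> small \<kappa> B \<and> small \<kappa> C \<and> small \<kappa> D \<and>
        R A C B \<and> B \<subseteq> D \<longrightarrow> (\<exists>f. realizes S (B \<union> C) A f \<and> R (f ` A) C D))"

definition ind_M :: "('f, 'r, 'm) struct \<Rightarrow> 'm ternary \<Rightarrow> 'm ternary" where
  "ind_M S R A C B \<longleftrightarrow> (\<forall>D. C \<subseteq> D \<and> D \<subseteq> acl S (B \<union> C) \<longrightarrow> R A D B)"

text \<open>
  \<open>\<phi>(x, b)\<close>, with \<open>x\<close> of length \<open>n\<close>, divides over \<open>C\<close> if for some \<open>k\<close> there is a sequence of
  realizations \<open>b\<^sub>i\<close> of \<open>tp(b/C)\<close> such that the \<open>\<phi>(x, b\<^sub>i)\<close> are \<open>k\<close>-inconsistent.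
\<close>

definition fm_divides ::
  "('f, 'r, 'm) struct \<Rightarrow> 'm set \<Rightarrow> nat \<Rightarrow> ('f, 'r) fm \<Rightarrow> 'm list \<Rightarrow> bool" where
  "fm_divides S C n \<phi> b \<longleftrightarrow>
     wf_fm S (n + length b) \<phi> \<and>
     (\<exists>(bs :: nat \<Rightarrow> 'm list) k.
        (\<forall>i. list_tp_eq S C (bs i) b) \<and>
        (\<forall>J. finite J \<and> card J = k \<longrightarrow>
           \<not> (\<exists>xs. length xs = n \<and> (\<forall>i \<in> J. holds S (xs @ bs i) \<phi>))))"

text \<open>
  \<open>tp(A/B)\<close> divides over \<open>C\<close> if it implies a formula that divides over \<open>C\<close>, and forks over \<open>C\<close> if it
  implies a finite disjunction of such formulas. A formula in the variables \<open>(x\<^sub>a)\<close>, \<open>a \<in> A\<close>, and with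
  arbitrary parameters is given as a triple \<open>(as, \<phi>, b)\<close>: its variables are the \<open>x\<^sub>a\<close> for \<open>a\<close> in the
  list \<open>as\<close>, its parameters are \<open>b\<close>. A realization \<open>f\<close> satisfies it if \<open>\<phi>(f(as), b)\<close> holds.
\<close>

definition tp_divides :: "('f, 'r, 'm) struct \<Rightarrow> 'm set \<Rightarrow> 'm set \<Rightarrow> 'm set \<Rightarrow> bool" where
  "tp_divides S A B C \<longleftrightarrow>
     (\<exists>as \<phi> b. set as \<subseteq> A \<and> fm_divides S C (length as) \<phi> b \<and>
        (\<forall>f. realizes S B A f \<longrightarrow> holds S (map f as @ b) \<phi>))"

definition tp_forks :: "('f, 'r, 'm) struct \<Rightarrow> 'm set \<Rightarrow> 'm set \<Rightarrow> 'm set \<Rightarrow> bool" where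
  "tp_forks S A B C \<longleftrightarrow>
     (\<exists>\<Phi>. finite \<Phi> \<and>
        (\<forall>(as, \<phi>, b) \<in> \<Phi>. set as \<subseteq> A \<and> fm_divides S C (length as) \<phi> b) \<and>
        (\<forall>f. realizes S B A f \<longrightarrow> (\<exists>(as, \<phi>, b) \<in> \<Phi>. holds S (map f as @ b) \<phi>)))"

definition ind_d :: "('f, 'r, 'm) struct \<Rightarrow> 'm ternary" where
  "ind_d S A C B \<longleftrightarrow> \<not> tp_divides S A (B \<union> C) C"

definition ind_f :: "('f, 'r, 'm) struct \<Rightarrow> 'm ternary" where
  "ind_f S A C B \<longleftrightarrow> \<not> tp_forks S A (B \<union> C) C"

definition ind_da :: "('f, 'r, 'm) struct \<Rightarrow> 'm ternary" where
  "ind_da S A C B \<longleftrightarrow> ind_d S A C (acl S (B \<union> C))"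

definition ind_h :: "('f, 'r, 'm) struct \<Rightarrow> 'm ternary" where
  "ind_h S A C B \<longleftrightarrow>
     (\<forall>\<phi> as bs. set as \<subseteq> A \<and> set bs \<subseteq> B \<union> C \<and> wf_fm S (length as + length bs) \<phi> \<and>
        holds S (as @ bs) \<phi> \<longrightarrow>
        (\<exists>cs. set cs \<subseteq> C \<and> length cs = length as \<and> holds S (cs @ bs) \<phi>))"

text \<open>
  The tuples \<open>c\<^sub>1\<close>, \<open>c\<^sub>2\<close>, \<open>c\<close> are indexed by a small set \<open>I\<close> of elements of the underlying type of \<open>\<kappa>\<close>,
  which accommodates every length below \<open>\<kappa>\<close>. Of \<open>a\<close> and \<open>b\<close> only the sets of entries matter.
\<close>

definition h_amalgamation :: "('f, 'r, 'm) struct \<Rightarrow> 'k rel \<Rightarrow> 'm ternary \<Rightarrow> bool" where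
  "h_amalgamation S \<kappa> R \<longleftrightarrow>
     (\<forall>M A B (I :: 'k set) c1 c2.
        small_model S \<kappa> M \<and> small \<kappa> A \<and> small \<kappa> B \<and> small \<kappa> I \<and>
        tp_eq S M I c1 c2 \<and> R (c1 ` I) M A \<and> R (c2 ` I) M B \<and> ind_h S A M B \<longrightarrow>
        (\<exists>c. R (c ` I) M (A \<union> B) \<and> tp_eq S (M \<union> A) I c c1 \<and> tp_eq S (M \<union> B) I c c2))"

end

theory Submission
  imports Defs
begin

text \<open>
  The implications \<open>\<perp>\<^sup>d\<^sup>a \<rightarrow> \<perp>\<^sup>M \<rightarrow> \<perp>\<^sup>f \<rightarrow> \<perp>\<^sup>d\<^sup>a\<close> are proved in a circle. The first holds because nondividing is
  preserved by enlarging the base. For the last, if a formula dividing over \<open>C\<close> follows from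
  \<open>tp(A/acl(BC))\<close>, then by compactness it follows from some \<open>\<psi>(x, d)\<close> with \<open>d\<close> in \<open>acl(BC)\<close>, and
  \<open>tp(A/BC)\<close> implies the disjunction of the finitely many conjugates of \<open>\<psi>(x, d)\<close> over \<open>BC\<close>, each of
  which divides over \<open>C\<close>.

  For \<open>\<perp>\<^sup>M \<rightarrow> \<perp>\<^sup>f\<close>, extension reduces forking to dividing. Let \<open>b\<^sub>i\<close> witness that \<open>\<phi>(x, b)\<close> divides
  over \<open>C\<close>, let \<open>M \<supseteq> C\<close> be a small model containing all \<open>b\<^sub>i\<close>, and let \<open>p\<close> be the limit of the types of
  the \<open>b\<^sub>i\<close> along a nonprincipal ultrafilter, a global type finitely satisfiable in \<open>M\<close>. Successive
  realizations \<open>y\<^sub>j\<close> of \<open>p\<close> over \<open>M y\<^sub>0 \<dots> y\<^sub>j\<^sub>-\<^sub>1\<close> satisfy \<open>y\<^sub>j \<perp>\<^sup>h\<^sub>M y\<^sub>0 \<dots> y\<^sub>j\<^sub>-\<^sub>1\<close>, and the \<open>\<phi>(x, y\<^sub>j)\<close> are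
  inconsistent as well. But if \<open>a \<perp>\<^sup>M\<^sub>C b\<close> realizes \<open>\<phi>(x, b)\<close>, then after moving \<open>b\<close> to \<open>y\<^sub>0\<close> and extending
  to \<open>M\<close> we get \<open>a \<perp>\<^sub>M y\<^sub>0\<close>, and amalgamating the conjugates of \<open>a\<close> over \<open>M\<close> one \<open>y\<^sub>j\<close> at a time yields a
  common realization.
\<close>

section \<open>Definable sets\<close>

primrec rename_tm :: "(nat \<Rightarrow> nat) \<Rightarrow> 'f tm \<Rightarrow> 'f tm" where
  "rename_tm \<rho> (Var k) = Var (\<rho> k)"
| "rename_tm \<rho> (App f ts) = App f (map (rename_tm \<rho>) ts)"

fun lift_var :: "(nat \<Rightarrow> nat) \<Rightarrow> nat \<Rightarrow> nat" where
  "lift_var \<rho> 0 = 0"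
| "lift_var \<rho> (Suc k) = Suc (\<rho> k)"

primrec rename_fm :: "(nat \<Rightarrow> nat) \<Rightarrow> ('f, 'r) fm \<Rightarrow> ('f, 'r) fm" where
  "rename_fm \<rho> (Equal t u) = Equal (rename_tm \<rho> t) (rename_tm \<rho> u)"
| "rename_fm \<rho> (Rel r ts) = Rel r (map (rename_tm \<rho>) ts)"
| "rename_fm \<rho> (Neg \<phi>) = Neg (rename_fm \<rho> \<phi>)"
| "rename_fm \<rho> (And \<phi> \<psi>) = And (rename_fm \<rho> \<phi>) (rename_fm \<rho> \<psi>)"
| "rename_fm \<rho> (Ex \<phi>) = Ex (rename_fm (lift_var \<rho>) \<phi>)"

lemma lift_var_less:
  assumes "\<forall>k<n. \<rho> k < m"
  shows "\<forall>k<Suc n. lift_var \<rho> k < Suc m"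
  using assms by (auto simp: less_Suc_eq_0_disj)

lemma wf_rename_tm:
  assumes "wf_tm S n t" "\<forall>k<n. \<rho> k < m"
  shows "wf_tm S m (rename_tm \<rho> t)"
  using assms by (induction t) auto

lemma wf_rename_fm:
  assumes "wf_fm S n \<phi>" "\<forall>k<n. \<rho> k < m"
  shows "wf_fm S m (rename_fm \<rho> \<phi>)"
  using assms
proof (induction \<phi> arbitrary: n m \<rho>)
  case (Ex \<phi>)
  show ?case
    using Ex.IH[of "Suc n" "lift_var \<rho>" "Suc m"] Ex.prems lift_var_less[of n \<rho> m] by simp
qed (fastforce intro: wf_rename_tm)+

lemma eval_rename:
  assumes "wf_tm S n t" "\<forall>k<n. e' ! k = e ! \<rho> k"
  shows "eval S e (rename_tm \<rho> t) = eval S e' t"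
  using assms
proof (induction t)
  case (App f ts)
  then have "map (eval S e \<circ> rename_tm \<rho>) ts = map (eval S e') ts" by auto
  then show ?case by (simp del: map_eq_conv)
qed simp

lemma sat_rename:
  assumes "wf_fm S n \<phi>" "\<forall>k<n. e' ! k = e ! \<rho> k"
  shows "sat S U e (rename_fm \<rho> \<phi>) \<longleftrightarrow> sat S U e' \<phi>"
  using assms
proof (induction \<phi> arbitrary: n e e' \<rho>)
  case (Equal t u)
  then show ?case using eval_rename[of S n t e' e \<rho>] eval_rename[of S n u e' e \<rho>] by simp
next
  case (Rel r ts)
  then have "map (eval S e \<circ> rename_tm \<rho>) ts = map (eval S e') ts"
    using eval_rename[of S n _ e' e \<rho>] by auto
  then show ?case by (simp del: map_eq_conv)
next
  case (Ex \<phi>)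
  have "sat S U (m # e) (rename_fm (lift_var \<rho>) \<phi>) \<longleftrightarrow> sat S U (m # e') \<phi>" for m
    by (rule Ex.IH[of "Suc n"]) (use Ex.prems in \<open>auto simp: less_Suc_eq_0_disj\<close>)
  then show ?case by simp
qed auto

text \<open>Formulas are handled semantically from here on: the closure lemmas below hide the
  indices and the parameter lists. Only the values of \<open>P\<close> on lists of length
  \<open>n\<close> count.\<close>

definition definable :: "('f, 'r, 'm) struct \<Rightarrow> 'm set \<Rightarrow> nat \<Rightarrow> ('m list \<Rightarrow> bool) \<Rightarrow> bool" where
  "definable S B n P \<longleftrightarrow> (\<exists>\<phi> bs. set bs \<subseteq> B \<and> wf_fm S (n + length bs) \<phi> \<and>
     (\<forall>xs. length xs = n \<longrightarrow> (P xs \<longleftrightarrow> holds S (xs @ bs) \<phi>)))"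

lemma definable_formula:
  "\<lbrakk>wf_fm S (n + length bs) \<phi>; set bs \<subseteq> B\<rbrakk> \<Longrightarrow> definable S B n (\<lambda>xs. holds S (xs @ bs) \<phi>)"
  unfolding definable_def by blast

lemma definable_mono: "\<lbrakk>definable S B n P; B \<subseteq> B'\<rbrakk> \<Longrightarrow> definable S B' n P"
  unfolding definable_def by blast

lemma definable_cong:
  "\<lbrakk>definable S B n P; \<And>xs. length xs = n \<Longrightarrow> P xs \<longleftrightarrow> Q xs\<rbrakk> \<Longrightarrow> definable S B n Q"
  unfolding definable_def by blast

lemma definable_True: "definable S B n (\<lambda>_. True)"
  unfolding definable_def
  by (rule exI[of _ "Ex (Equal (Var 0) (Var 0))"], rule exI[of _ "[]"]) simp

lemma definable_not:
  assumes "definable S B n P"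
  shows "definable S B n (\<lambda>xs. \<not> P xs)"
proof -
  obtain \<phi> bs where "set bs \<subseteq> B" "wf_fm S (n + length bs) \<phi>"
    "\<forall>xs. length xs = n \<longrightarrow> (P xs \<longleftrightarrow> holds S (xs @ bs) \<phi>)"
    using assms unfolding definable_def by blast
  then show ?thesis
    unfolding definable_def by (intro exI[of _ "Neg \<phi>"] exI[of _ bs]) simp
qed

lemma definable_conj:
  assumes "definable S B n P" "definable S B n Q"
  shows "definable S B n (\<lambda>xs. P xs \<and> Q xs)"
proof -
  obtain \<phi> bs where p: "set bs \<subseteq> B" "wf_fm S (n + length bs) \<phi>"
    "\<forall>xs. length xs = n \<longrightarrow> (P xs \<longleftrightarrow> holds S (xs @ bs) \<phi>)"
    using assms(1) unfolding definable_def by blast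
  obtain \<psi> cs where q: "set cs \<subseteq> B" "wf_fm S (n + length cs) \<psi>"
    "\<forall>xs. length xs = n \<longrightarrow> (Q xs \<longleftrightarrow> holds S (xs @ cs) \<psi>)"
    using assms(2) unfolding definable_def by blast
  \<comment> \<open>The parameters of the conjunction are \<open>bs @ cs\<close>, so
    \<open>\<rho>\<close> fixes the \<open>n\<close> variables and moves the parameters of
    \<open>\<psi>\<close> past \<open>bs\<close>.\<close>
  define \<rho> where "\<rho> = (\<lambda>k. if k < n then k else k + length bs)"
  define \<chi> where "\<chi> = And (rename_fm (\<lambda>k. k) \<phi>) (rename_fm \<rho> \<psi>)"
  have 1: "wf_fm S (n + length (bs @ cs)) (rename_fm (\<lambda>k. k) \<phi>)"
    by (rule wf_rename_fm[OF p(2)]) auto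
  have 2: "wf_fm S (n + length (bs @ cs)) (rename_fm \<rho> \<psi>)"
    by (rule wf_rename_fm[OF q(2)]) (auto simp: \<rho>_def)
  have 3: "P xs \<longleftrightarrow> holds S (xs @ bs @ cs) (rename_fm (\<lambda>k. k) \<phi>)" if "length xs = n" for xs
  proof -
    have "holds S (xs @ bs @ cs) (rename_fm (\<lambda>k. k) \<phi>) \<longleftrightarrow> holds S (xs @ bs) \<phi>"
      by (rule sat_rename[OF p(2)]) (use that in \<open>auto simp: nth_append\<close>)
    then show ?thesis using p(3) that by blast
  qed
  have 4: "Q xs \<longleftrightarrow> holds S (xs @ bs @ cs) (rename_fm \<rho> \<psi>)" if "length xs = n" for xs
  proof -
    have "holds S (xs @ bs @ cs) (rename_fm \<rho> \<psi>) \<longleftrightarrow> holds S (xs @ cs) \<psi>"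
      by (rule sat_rename[OF q(2)]) (use that in \<open>auto simp: nth_append \<rho>_def\<close>)
    then show ?thesis using q(3) that by blast
  qed
  show ?thesis
    unfolding definable_def
    by (rule exI[of _ \<chi>], rule exI[of _ "bs @ cs"])
      (use p(1) q(1) 1 2 3 4 in \<open>auto simp: \<chi>_def\<close>)
qed

lemma definable_Ball:
  assumes "finite F" "\<And>i. i \<in> F \<Longrightarrow> definable S B n (P i)"
  shows "definable S B n (\<lambda>xs. \<forall>i\<in>F. P i xs)"
  using assms
proof (induction F)
  case empty
  then show ?case using definable_True[of S B n] by simp
next
  case (insert i F)
  have "definable S B n (\<lambda>xs. P i xs \<and> (\<forall>i\<in>F. P i xs))"
    using insert by (intro definable_conj) auto
  then show ?case by (simp add: definable_cong)
qed

lemma definable_subst: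
  assumes "definable S B n P" "\<forall>i<n. \<rho> i < m"
  shows "definable S B m (\<lambda>xs. P (map (\<lambda>i. xs ! \<rho> i) [0..<n]))"
proof -
  obtain \<phi> bs where p: "set bs \<subseteq> B" "wf_fm S (n + length bs) \<phi>"
    "\<forall>xs. length xs = n \<longrightarrow> (P xs \<longleftrightarrow> holds S (xs @ bs) \<phi>)"
    using assms(1) unfolding definable_def by blast
  define \<rho>' where "\<rho>' = (\<lambda>k. if k < n then \<rho> k else (k - n) + m)"
  have "wf_fm S (m + length bs) (rename_fm \<rho>' \<phi>)"
    by (rule wf_rename_fm[OF p(2)]) (use assms(2) in \<open>auto simp: \<rho>'_def trans_less_add1\<close>)
  moreover have "P (map (\<lambda>i. xs ! \<rho> i) [0..<n]) \<longleftrightarrow> holds S (xs @ bs) (rename_fm \<rho>' \<phi>)"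
    if "length xs = m" for xs
  proof -
    have "holds S (xs @ bs) (rename_fm \<rho>' \<phi>) \<longleftrightarrow>
      holds S (map (\<lambda>i. xs ! \<rho> i) [0..<n] @ bs) \<phi>"
      by (rule sat_rename[OF p(2)])
        (use that assms(2) in \<open>auto simp: nth_append \<rho>'_def\<close>)
    then show ?thesis using p(3) by simp
  qed
  ultimately show ?thesis unfolding definable_def using p(1) by blast
qed

lemma definable_take:
  assumes "definable S B n P"
  shows "definable S B (n + m) (\<lambda>xs. P (take n xs))"
proof -
  have *: "definable S B (n + m) (\<lambda>xs. P (map (\<lambda>i. xs ! i) [0..<n]))"
    by (rule definable_subst[OF assms]) auto
  have "map (\<lambda>i. xs ! i) [0..<n] = take n xs" if "length xs = n + m" for xs :: "'c list"
    using that by (auto intro!: nth_equalityI)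
  then show ?thesis using definable_cong[OF *] by auto
qed

lemma definable_param:
  assumes "definable S B (n + length cs) P" "set cs \<subseteq> B"
  shows "definable S B n (\<lambda>xs. P (xs @ cs))"
proof -
  obtain \<phi> bs where p: "set bs \<subseteq> B" "wf_fm S (n + length cs + length bs) \<phi>"
    "\<forall>xs. length xs = n + length cs \<longrightarrow> (P xs \<longleftrightarrow> holds S (xs @ bs) \<phi>)"
    using assms(1) unfolding definable_def by blast
  show ?thesis
    unfolding definable_def
    by (rule exI[of _ \<phi>], rule exI[of _ "cs @ bs"]) (use p assms(2) in \<open>auto simp: add.assoc\<close>)
qed

lemma definable_Ex:
  assumes "definable S B (Suc n) P"
  shows "definable S B n (\<lambda>xs. \<exists>x. P (x # xs))"
proof -
  obtain \<phi> bs where p: "set bs \<subseteq> B" "wf_fm S (Suc n + length bs) \<phi>"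
    "\<forall>xs. length xs = Suc n \<longrightarrow> (P xs \<longleftrightarrow> holds S (xs @ bs) \<phi>)"
    using assms(1) unfolding definable_def by blast
  show ?thesis
    unfolding definable_def
    by (rule exI[of _ "Ex \<phi>"], rule exI[of _ bs]) (use p in auto)
qed

lemma definable_Ex_list:
  assumes "definable S B (k + n) P"
  shows "definable S B n (\<lambda>xs. \<exists>ys. length ys = k \<and> P (ys @ xs))"
  using assms
proof (induction k arbitrary: P)
  case (Suc k)
  have "definable S B n (\<lambda>xs. \<exists>ys. length ys = k \<and> (\<exists>y. P (y # ys @ xs)))"
    using Suc.IH[of "\<lambda>zs. \<exists>y. P (y # zs)"] definable_Ex[of S B "k + n" P] Suc.prems by simp
  moreover have "(\<exists>ys. length ys = Suc k \<and> P (ys @ xs)) \<longleftrightarrow>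
      (\<exists>ys. length ys = k \<and> (\<exists>y. P (y # ys @ xs)))" for xs
    by (force simp: length_Suc_conv)
  ultimately show ?case by simp
qed simp

lemma definable_eq_const: "c \<in> B \<Longrightarrow> definable S B 1 (\<lambda>xs. hd xs = c)"
  unfolding definable_def
  by (rule exI[of _ "Equal (Var 0) (Var 1)"], rule exI[of _ "[c]"]) (auto simp: length_Suc_conv)

section \<open>Equality of types, tested on definable predicates\<close>

lemma list_tp_eq_definable:
  assumes "list_tp_eq S B xs ys" "definable S B (length xs) P"
  shows "P xs \<longleftrightarrow> P ys"
  using assms unfolding list_tp_eq_def definable_def by metis

lemma list_tp_eqI:
  assumes "length xs = length ys" "\<And>P. definable S B (length xs) P \<Longrightarrow> P xs \<longleftrightarrow> P ys"
  shows "list_tp_eq S B xs ys"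
  unfolding list_tp_eq_def
  using assms(1) assms(2)[OF definable_formula] by blast

lemma list_tp_eq_refl: "list_tp_eq S B xs xs"
  unfolding list_tp_eq_def by simp

lemma list_tp_eq_sym: "list_tp_eq S B xs ys \<Longrightarrow> list_tp_eq S B ys xs"
  unfolding list_tp_eq_def by simp

lemma list_tp_eq_trans: "\<lbrakk>list_tp_eq S B xs ys; list_tp_eq S B ys zs\<rbrakk> \<Longrightarrow> list_tp_eq S B xs zs"
  unfolding list_tp_eq_def by simp

lemma list_tp_eq_mono: "\<lbrakk>list_tp_eq S B xs ys; C \<subseteq> B\<rbrakk> \<Longrightarrow> list_tp_eq S C xs ys"
  unfolding list_tp_eq_def by blast

lemma list_tp_eq_length: "list_tp_eq S B xs ys \<Longrightarrow> length xs = length ys"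
  unfolding list_tp_eq_def by simp

lemma tp_eq_mono: "\<lbrakk>tp_eq S B I a a'; C \<subseteq> B; J \<subseteq> I\<rbrakk> \<Longrightarrow> tp_eq S C J a a'"
  unfolding tp_eq_def list_tp_eq_def by (meson subset_trans)

lemma tp_eq_holds:
  assumes "tp_eq S B I a a'" "set is \<subseteq> I" "set bs \<subseteq> B" "wf_fm S (length is + length bs) \<phi>"
  shows "holds S (map a is @ bs) \<phi> \<longleftrightarrow> holds S (map a' is @ bs) \<phi>"
  using assms unfolding tp_eq_def list_tp_eq_def by simp

section \<open>Automorphisms and homogeneity\<close>

lemma eval_automorphism:
  assumes "automorphism S \<sigma>" "wf_tm S (length e) t"
  shows "eval S (map \<sigma> e) t = \<sigma> (eval S e t)"
  using assms(2)
proof (induction t)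
  case (App f ts)
  then have "map (eval S (map \<sigma> e)) ts = map \<sigma> (map (eval S e) ts)" by auto
  then show ?case using App.prems assms(1) by (simp add: automorphism_def del: map_eq_conv map_map)
qed simp

lemma holds_automorphism:
  assumes "automorphism S \<sigma>" "wf_fm S (length e) \<phi>"
  shows "holds S (map \<sigma> e) \<phi> \<longleftrightarrow> holds S e \<phi>"
  using assms(2)
proof (induction \<phi> arbitrary: e)
  case (Equal t u)
  then show ?case
    using eval_automorphism[OF assms(1)] assms(1) by (simp add: automorphism_def bij_def inj_eq)
next
  case (Rel r ts)
  then have "map (eval S (map \<sigma> e)) ts = map \<sigma> (map (eval S e) ts)"
    using eval_automorphism[OF assms(1)] by auto
  then show ?case using Rel.prems assms(1) by (simp add: automorphism_def del: map_eq_conv map_map)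
next
  case (Ex \<phi>)
  have "(\<exists>m. holds S (m # map \<sigma> e) \<phi>) \<longleftrightarrow> (\<exists>m. holds S (\<sigma> m # map \<sigma> e) \<phi>)"
    using assms(1) unfolding automorphism_def by (metis bij_pointE)
  also have "\<dots> \<longleftrightarrow> (\<exists>m. holds S (m # e) \<phi>)"
    using Ex.IH[of "_ # e"] Ex.prems by simp
  finally show ?case by simp
qed auto

lemma automorphism_list_tp_eq:
  assumes "automorphism S \<sigma>" "\<forall>c\<in>C. \<sigma> c = c"
  shows "list_tp_eq S C xs (map \<sigma> xs)"
proof -
  have "holds S (xs @ cs) \<phi> \<longleftrightarrow> holds S (map \<sigma> xs @ cs) \<phi>"
    if "set cs \<subseteq> C" "wf_fm S (length xs + length cs) \<phi>" for \<phi> cs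
  proof -
    have "map \<sigma> cs = cs" using that(1) assms(2) by (simp add: map_idI subset_iff)
    then show ?thesis using holds_automorphism[OF assms(1), of "xs @ cs" \<phi>] that(2) by simp
  qed
  then show ?thesis unfolding list_tp_eq_def by simp
qed

lemma automorphism_tp_eq:
  assumes "automorphism S \<sigma>" "\<forall>c\<in>C. \<sigma> c = c"
  shows "tp_eq S C I a (\<sigma> \<circ> a)"
  unfolding tp_eq_def map_map[symmetric] using automorphism_list_tp_eq[OF assms] by blast

lemma automorphism_realizes:
  assumes "automorphism S \<sigma>" "\<forall>c\<in>C. \<sigma> c = c"
  shows "realizes S C A \<sigma>"
  using automorphism_tp_eq[OF assms, of A "\<lambda>x. x"] by (simp add: comp_def)

section \<open>Closure properties of smallness\<close>

lemma monster_infinite: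
  assumes "monster S \<kappa>"
  shows "\<not> finite (Field \<kappa>)"
proof
  assume "finite (Field \<kappa>)"
  then have "|Field \<kappa>| <o natLeq" by (simp add: finite_iff_ordLess_natLeq)
  moreover have \<kappa>: "Card_order \<kappa>" "natLeq <o \<kappa>" using assms by (auto simp: monster_def)
  ultimately have "|Field \<kappa>| <o \<kappa>" using ordLess_transitive by blast
  moreover have "|Field \<kappa>| =o \<kappa>" by (rule card_of_Field_ordIso[OF \<kappa>(1)])
  ultimately show False using not_ordLess_ordIso by blast
qed

lemma small_Un: "\<lbrakk>monster S \<kappa>; small \<kappa> A; small \<kappa> B\<rbrakk> \<Longrightarrow> small \<kappa> (A \<union> B)"
  using card_of_Un_ordLess_infinite_Field[of \<kappa> A B] monster_infinite
  unfolding monster_def small_def by blast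

lemma small_image: "small \<kappa> A \<Longrightarrow> small \<kappa> (f ` A)"
  unfolding small_def using card_of_image ordLeq_ordLess_trans by blast

lemma small_subset: "\<lbrakk>small \<kappa> B; A \<subseteq> B\<rbrakk> \<Longrightarrow> small \<kappa> A"
  unfolding small_def using card_of_mono1 ordLeq_ordLess_trans by blast

lemma small_finite: "\<lbrakk>monster S \<kappa>; finite A\<rbrakk> \<Longrightarrow> small \<kappa> A"
  unfolding small_def monster_def using finite_iff_ordLess_natLeq ordLess_transitive by blast

text \<open>The map that is the identity on \<open>C\<close> and sends \<open>a i\<close> to
  \<open>a' i\<close> is well defined because types contain equalities, and elementary because the
  types agree over \<open>C\<close>. Strong homogeneity extends it.\<close>

lemma extend_to_automorphism:
  assumes mon: "monster S \<kappa>" and C: "small \<kappa> C" and I: "small \<kappa> (a ` I)" and eq: "tp_eq S C I a a'"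
  obtains \<sigma> where "automorphism S \<sigma>" "\<forall>c\<in>C. \<sigma> c = c" "\<forall>i\<in>I. \<sigma> (a i) = a' i"
proof -
  \<comment> \<open>\<open>a\<close> may repeat values, so each value gets one chosen index.\<close>
  define pick where "pick = (\<lambda>m. SOME i. i \<in> I \<and> a i = m)"
  define f where "f = (\<lambda>m. if m \<in> C then m else a' (pick m))"
  have pick: "pick (a i) \<in> I \<and> a (pick (a i)) = a i" if "i \<in> I" for i
    unfolding pick_def by (rule someI[of _ i]) (use that in simp)
  have fI: "f (a i) = a' i" if i: "i \<in> I" for i
  proof (cases "a i \<in> C")
    case True
    have "holds S (map a [i] @ [a i]) (Equal (Var 0) (Var 1)) \<longleftrightarrow>
        holds S (map a' [i] @ [a i]) (Equal (Var 0) (Var 1))"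
      by (rule tp_eq_holds[OF eq]) (use True i in auto)
    then show ?thesis using True by (simp add: f_def)
  next
    case False
    have "holds S (map a [i, pick (a i)] @ []) (Equal (Var 0) (Var 1)) \<longleftrightarrow>
        holds S (map a' [i, pick (a i)] @ []) (Equal (Var 0) (Var 1))"
      by (rule tp_eq_holds[OF eq]) (use i pick[OF i] in auto)
    then show ?thesis using False pick[OF i] by (simp add: f_def)
  qed
  have "list_tp_eq S {} zs (map f zs)" if zs: "set zs \<subseteq> C \<union> a ` I" for zs
  proof -
    \<comment> \<open>Every entry of \<open>zs\<close> occurs in \<open>map a is @ cs\<close>, so
      \<open>zs\<close> is a rearrangement, along \<open>\<rho>\<close>, of a tuple to which
      \<open>eq\<close> applies; \<open>map f zs\<close> is the same rearrangement of
      \<open>map a' is @ cs\<close>.\<close>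
    define "is" where "is = map pick (filter (\<lambda>z. z \<notin> C) zs)"
    define cs where "cs = filter (\<lambda>z. z \<in> C) zs"
    have isI: "set is \<subseteq> I" using zs pick by (auto simp: is_def)
    have csC: "set cs \<subseteq> C" by (auto simp: cs_def)
    have "\<exists>j < length is + length cs. zs ! k = (map a is @ cs) ! j \<and>
        f (zs ! k) = (map a' is @ cs) ! j" if k: "k < length zs" for k
    proof (cases "zs ! k \<in> C")
      case True
      then have "zs ! k \<in> set cs" using k by (simp add: cs_def)
      then obtain j where "j < length cs" "cs ! j = zs ! k" by (meson in_set_conv_nth)
      then show ?thesis
        using True by (intro exI[of _ "length is + j"]) (simp add: nth_append f_def)
    next
      case False
      then have *: "pick (zs ! k) \<in> set is" using k by (simp add: is_def)
      then obtain j where j: "j < length is" "is ! j = pick (zs ! k)" by (meson in_set_conv_nth)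
      have "zs ! k \<in> a ` I" using False zs k nth_mem by blast
      then have "a (pick (zs ! k)) = zs ! k" using pick by auto
      then show ?thesis
        using False j by (intro exI[of _ j]) (simp add: nth_append f_def)
    qed
    then obtain \<rho> where \<rho>: "\<forall>k<length zs. \<rho> k < length is + length cs \<and>
        zs ! k = (map a is @ cs) ! \<rho> k \<and> f (zs ! k) = (map a' is @ cs) ! \<rho> k"
      by metis
    have "holds S zs \<phi> \<longleftrightarrow> holds S (map f zs) \<phi>" if wf: "wf_fm S (length zs) \<phi>" for \<phi>
    proof -
      have "holds S zs \<phi> \<longleftrightarrow> holds S (map a is @ cs) (rename_fm \<rho> \<phi>)"
        by (rule sat_rename[OF wf, symmetric]) (use \<rho> in simp)
      also have "\<dots> \<longleftrightarrow> holds S (map a' is @ cs) (rename_fm \<rho> \<phi>)"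
        by (rule tp_eq_holds[OF eq isI csC], rule wf_rename_fm[OF wf]) (use \<rho> in simp)
      also have "\<dots> \<longleftrightarrow> holds S (map f zs) \<phi>"
        by (rule sat_rename[OF wf]) (use \<rho> in \<open>metis nth_map\<close>)
      finally show ?thesis .
    qed
    then show ?thesis unfolding list_tp_eq_def by simp
  qed
  then have "realizes S {} (C \<union> a ` I) f" unfolding tp_eq_def by simp
  moreover have "small \<kappa> (C \<union> a ` I)" by (rule small_Un[OF mon C I])
  ultimately obtain \<sigma> where \<sigma>: "automorphism S \<sigma>" "\<forall>m \<in> C \<union> a ` I. \<sigma> m = f m"
    using mon unfolding monster_def strongly_homogeneous_def by blast
  show thesis
  proof (rule that[OF \<sigma>(1)])
    show "\<forall>c\<in>C. \<sigma> c = c" using \<sigma>(2) by (simp add: f_def)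
    show "\<forall>i\<in>I. \<sigma> (a i) = a' i" using \<sigma>(2) fI by simp
  qed
qed

text \<open>A list becomes a tuple indexed by its positions; an index list with repetitions or gaps
  is absorbed by a substitution of variables.\<close>

lemma list_tp_eq_imp_tp_eq:
  assumes "list_tp_eq S C xs ys"
  shows "tp_eq S C {..<length xs} ((!) xs) ((!) ys)"
  unfolding tp_eq_def
proof (intro allI impI)
  fix "is" assume "set is \<subseteq> {..<length xs}"
  then have le: "\<forall>i<length is. is ! i < length xs" by (auto simp: subset_iff)
  show "list_tp_eq S C (map ((!) xs) is) (map ((!) ys) is)"
  proof (rule list_tp_eqI)
    fix P assume "definable S C (length (map ((!) xs) is)) P"
    then have "definable S C (length xs) (\<lambda>zs. P (map (\<lambda>i. zs ! (is ! i)) [0..<length is]))"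
      using definable_subst[OF _ le] by simp
    moreover have "map (\<lambda>i. zs ! (is ! i)) [0..<length is] = map ((!) zs) is" for zs :: "'c list"
      by (rule nth_equalityI) simp_all
    ultimately have "definable S C (length xs) (\<lambda>zs. P (map ((!) zs) is))" by simp
    from list_tp_eq_definable[OF assms this]
    show "P (map ((!) xs) is) \<longleftrightarrow> P (map ((!) ys) is)" .
  qed simp
qed

lemma list_tp_eq_automorphism:
  assumes "monster S \<kappa>" "small \<kappa> C" "list_tp_eq S C xs ys"
  obtains \<sigma> where "automorphism S \<sigma>" "\<forall>c\<in>C. \<sigma> c = c" "map \<sigma> xs = ys"
proof -
  have "small \<kappa> ((!) xs ` {..<length xs})" by (rule small_finite[OF assms(1)]) simp
  from extend_to_automorphism[OF assms(1,2) this list_tp_eq_imp_tp_eq[OF assms(3)]]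
  obtain \<sigma> where \<sigma>: "automorphism S \<sigma>" "\<forall>c\<in>C. \<sigma> c = c"
    "\<forall>i\<in>{..<length xs}. \<sigma> (xs ! i) = ys ! i" .
  have "map \<sigma> xs = ys"
    using \<sigma>(3) list_tp_eq_length[OF assms(3)] by (intro nth_equalityI) auto
  with \<sigma>(1,2) show thesis by (rule that)
qed

section \<open>Saturation\<close>

lemma saturated_1:
  assumes mon: "monster S \<kappa>" and B: "small \<kappa> B"
    and def: "\<And>D. D \<in> \<D> \<Longrightarrow> definable S B 1 (\<lambda>xs. xs \<in> D)"
    and fin: "\<And>q. \<lbrakk>q \<subseteq> \<D>; finite q\<rbrakk> \<Longrightarrow> \<exists>x. \<forall>D\<in>q. [x] \<in> D"
  shows "\<exists>x. \<forall>D\<in>\<D>. [x] \<in> D"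
proof -
  \<comment> \<open>\<open>ok D (\<phi>, bs)\<close> means that \<open>\<phi>\<close> with
    parameters \<open>bs\<close> defines the trace of \<open>D\<close> on one-element lists;
    \<open>saturated\<close> speaks of such pairs, not of sets.\<close>
  define ok where "ok = (\<lambda>D z. set (snd z) \<subseteq> B \<and> wf_fm S (Suc (length (snd z))) (fst z) \<and>
     (\<forall>x. [x] \<in> D \<longleftrightarrow> holds S (x # snd z) (fst z)))"
  have "\<exists>z. ok D z" if D: "D \<in> \<D>" for D
  proof -
    obtain \<phi> bs where *: "set bs \<subseteq> B" "wf_fm S (1 + length bs) \<phi>"
      "\<forall>xs. length xs = 1 \<longrightarrow> (xs \<in> D \<longleftrightarrow> holds S (xs @ bs) \<phi>)"
      using def[OF D] unfolding definable_def by blast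
    have "[x] \<in> D \<longleftrightarrow> holds S (x # bs) \<phi>" for x using *(3)[rule_format, of "[x]"] by simp
    then show ?thesis using *(1,2) by (intro exI[of _ "(\<phi>, bs)"]) (simp add: ok_def)
  qed
  then obtain F where F: "\<And>D. D \<in> \<D> \<Longrightarrow> ok D (F D)" by metis
  have sat: "saturated S \<kappa>" using mon by (simp add: monster_def)
  have "\<exists>x. \<forall>(\<phi>, bs) \<in> F ` \<D>. holds S (x # bs) \<phi>"
  proof (rule sat[unfolded saturated_def, rule_format, of B "F ` \<D>"], intro conjI allI impI)
    show "\<forall>(\<phi>, bs)\<in>F ` \<D>. wf_fm S (Suc (length bs)) \<phi> \<and> set bs \<subseteq> B"
      using F unfolding ok_def split_beta by blast
    fix q assume "q \<subseteq> F ` \<D>" "finite q"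
    then obtain q' where q': "q' \<subseteq> \<D>" "finite q'" "q = F ` q'"
      by (meson finite_subset_image)
    then obtain x where "\<forall>D\<in>q'. [x] \<in> D" using fin by blast
    then have "\<forall>z\<in>F ` q'. holds S (x # snd z) (fst z)"
      using F q'(1) unfolding ok_def by blast
    then show "\<exists>x. \<forall>(\<phi>, bs)\<in>q. holds S (x # bs) \<phi>"
      unfolding q'(3) split_beta by blast
  qed (rule B)
  then obtain x where x: "\<forall>z \<in> F ` \<D>. holds S (x # snd z) (fst z)"
    unfolding split_beta by blast
  have "[x] \<in> D" if "D \<in> \<D>" for D
    using F[OF that] x that unfolding ok_def by simp
  then show ?thesis by blast
qed

text \<open>Induction on \<open>n\<close>: the tail of the tuple is found first, by realizing all
  projections of finite intersections; the head then comes from saturation in one variable, with the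
  tail as parameters.\<close>

lemma saturated_n:
  assumes mon: "monster S \<kappa>" and B: "small \<kappa> B"
    and "\<And>D. D \<in> \<D> \<Longrightarrow> definable S B n (\<lambda>xs. xs \<in> D)"
    and "\<And>q. \<lbrakk>q \<subseteq> \<D>; finite q\<rbrakk> \<Longrightarrow> \<exists>xs. length xs = n \<and> (\<forall>D\<in>q. xs \<in> D)"
  shows "\<exists>xs. length xs = n \<and> (\<forall>D\<in>\<D>. xs \<in> D)"
  using assms(3,4)
proof (induction n arbitrary: \<D>)
  case 0
  have "[] \<in> D" if "D \<in> \<D>" for D
    using "0.prems"(2)[of "{D}"] that by simp
  then show ?case by simp
next
  case (Suc n)
  \<comment> \<open>\<open>pr q\<close> projects the intersection of \<open>q\<close> by forgetting
    the head. Asking for all finite \<open>q\<close> at once keeps the fibre over \<open>xs\<close>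
    finitely satisfiable.\<close>
  define pr where "pr = (\<lambda>q. {xs. \<exists>x. \<forall>D\<in>q. x # xs \<in> (D :: 'c list set)})"
  have "\<exists>xs. length xs = n \<and> (\<forall>E \<in> pr ` {q. q \<subseteq> \<D> \<and> finite q}. xs \<in> E)"
  proof (rule Suc.IH)
    fix E assume "E \<in> pr ` {q. q \<subseteq> \<D> \<and> finite q}"
    then obtain q where q: "q \<subseteq> \<D>" "finite q" "E = pr q" by blast
    have "definable S B (Suc n) (\<lambda>xs. \<forall>D\<in>q. xs \<in> D)"
      using q Suc.prems(1) by (intro definable_Ball) auto
    from definable_Ex[OF this] show "definable S B n (\<lambda>xs. xs \<in> E)"
      unfolding q(3) pr_def by simp
  next
    fix r assume r: "r \<subseteq> pr ` {q. q \<subseteq> \<D> \<and> finite q}" "finite r"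
    then obtain qs where qs: "qs \<subseteq> {q. q \<subseteq> \<D> \<and> finite q}" "finite qs" "r = pr ` qs"
      by (meson finite_subset_image)
    \<comment> \<open>Finitely many finite families have a finite union; the tail of a point common
      to all its members lies in every projection.\<close>
    have "\<Union>qs \<subseteq> \<D>" "finite (\<Union>qs)" using qs by auto
    then obtain zs where zs: "length zs = Suc n" "\<forall>D\<in>\<Union>qs. zs \<in> D"
      using Suc.prems(2) by blast
    then obtain x xs where x: "zs = x # xs" "length xs = n" by (auto simp: length_Suc_conv)
    have "\<forall>E\<in>r. xs \<in> E" using zs(2) x(1) unfolding qs(3) pr_def by blast
    then show "\<exists>xs. length xs = n \<and> (\<forall>E\<in>r. xs \<in> E)" using x by blast
  qed
  then obtain xs where xs: "length xs = n" "\<forall>q. q \<subseteq> \<D> \<and> finite q \<longrightarrow> xs \<in> pr q" by blast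
  define slice where "slice = (\<lambda>D. {zs. zs @ xs \<in> (D :: 'c list set)})"
  have "\<exists>x. \<forall>D \<in> slice ` \<D>. [x] \<in> D"
  proof (rule saturated_1[OF mon, of "B \<union> set xs"])
    show "small \<kappa> (B \<union> set xs)" by (rule small_Un[OF mon B small_finite[OF mon]]) simp
  next
    fix E assume "E \<in> slice ` \<D>"
    then obtain D where D: "D \<in> \<D>" "E = slice D" by blast
    then have "definable S (B \<union> set xs) (1 + length xs) (\<lambda>xs. xs \<in> D)"
      using definable_mono[OF Suc.prems(1), of D "B \<union> set xs"] xs(1) by simp
    from definable_param[OF this] show "definable S (B \<union> set xs) 1 (\<lambda>xs. xs \<in> E)"
      unfolding D(2) slice_def by simp
  next
    fix r assume "r \<subseteq> slice ` \<D>" "finite r"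
    then obtain q where q: "q \<subseteq> \<D>" "finite q" "r = slice ` q"
      by (meson finite_subset_image)
    then have "xs \<in> pr q" using xs(2) by blast
    then show "\<exists>x. \<forall>D\<in>r. [x] \<in> D" unfolding q(3) pr_def slice_def by simp
  qed
  then obtain x where "\<forall>D\<in>\<D>. x # xs \<in> D" by (auto simp: slice_def)
  then show ?case using xs(1) by (intro exI[of _ "x # xs"]) simp
qed

section \<open>Cardinality\<close>

text \<open>The closure of \<open>X\<close> under operations that accept argument lists of every
  length. Its instances are the terms, the formulas and the hull that serves as a small
  model.\<close>

inductive_set generated :: "'a set \<Rightarrow> 'p set \<Rightarrow> ('p \<Rightarrow> 'a list \<Rightarrow> 'a) \<Rightarrow> 'a set"
  for X :: "'a set" and P :: "'p set" and F :: "'p \<Rightarrow> 'a list \<Rightarrow> 'a" where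
  base: "x \<in> X \<Longrightarrow> x \<in> generated X P F"
| step: "\<lbrakk>p \<in> P; \<forall>x. x \<in> set xs \<longrightarrow> x \<in> generated X P F\<rbrakk> \<Longrightarrow> F p xs \<in> generated X P F"

section \<open>Cardinal bounds for lists, generated sets and formulas\<close>

lemma finite_ordLeq_infinite:
  assumes "finite A" "\<not> finite B"
  shows "|A| \<le>o |B|"
proof -
  have "|A| <o natLeq" "natLeq \<le>o |B|"
    using assms finite_iff_ordLess_natLeq infinite_iff_natLeq_ordLeq by blast+
  then show ?thesis using ordLess_ordLeq_trans ordLess_imp_ordLeq by blast
qed

text \<open>Lists of a fixed length are bounded by induction, as an infinite cardinal absorbs
  products; all lists form a countable union of these.\<close>

lemma card_of_lists_ordLeq:
  assumes inf: "\<not> finite (\<Lambda> :: 'l set)" and A: "|A| \<le>o |\<Lambda>|"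
  shows "|lists A| \<le>o |\<Lambda>|"
proof -
  define L where "L = (\<lambda>n. {xs \<in> lists A. length xs = n})"
  have "|L n| \<le>o |\<Lambda>|" for n
  proof (induction n)
    case 0
    have "L 0 = {[]}" by (auto simp: L_def)
    then have "finite (L 0)" by simp
    then show ?case using inf by (rule finite_ordLeq_infinite)
  next
    case (Suc n)
    have "L (Suc n) = (\<lambda>(x, xs). x # xs) ` (A \<times> L n)"
      by (auto simp: L_def length_Suc_conv image_iff)
    moreover have "|(\<lambda>(x, xs). x # xs) ` (A \<times> L n)| \<le>o |A \<times> L n|" by (rule card_of_image)
    moreover have "|A \<times> L n| \<le>o |\<Lambda>|"
      using card_of_Sigma_ordLeq_infinite[OF inf A, of "\<lambda>_. L n"] Suc by simp
    ultimately show ?case using ordLeq_transitive by metis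
  qed
  moreover have "|UNIV :: nat set| \<le>o |\<Lambda>|" using inf infinite_iff_card_of_nat by blast
  ultimately have "|\<Union>n. L n| \<le>o |\<Lambda>|" using card_of_UNION_ordLeq_infinite[OF inf] by blast
  moreover have "lists A = (\<Union>n. L n)" by (auto simp: L_def)
  ultimately show ?thesis by simp
qed

text \<open>The closure is exhausted by countably many stages, each adding the values of all
  operations on lists from the stage before.\<close>

lemma card_of_generated_ordLeq:
  assumes inf: "\<not> finite (\<Lambda> :: 'l set)" and X: "|X| \<le>o |\<Lambda>|" and P: "|P| \<le>o |\<Lambda>|"
  shows "|generated X P F| \<le>o |\<Lambda>|"
proof -
  define L where "L = rec_nat X (\<lambda>_ A. A \<union> (\<lambda>(p, xs). F p xs) ` (P \<times> lists A))"
  have L0: "L 0 = X" and LS: "L (Suc n) = L n \<union> (\<lambda>(p, xs). F p xs) ` (P \<times> lists (L n))" for n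
    by (simp_all add: L_def)
  have "|L n| \<le>o |\<Lambda>|" for n
  proof (induction n)
    case 0
    show ?case using X L0 by simp
  next
    case (Suc n)
    have "|P \<times> lists (L n)| \<le>o |\<Lambda>|"
      using card_of_Sigma_ordLeq_infinite[OF inf P, of "\<lambda>_. lists (L n)"]
        card_of_lists_ordLeq[OF inf Suc] by simp
    then have "|(\<lambda>(p, xs). F p xs) ` (P \<times> lists (L n))| \<le>o |\<Lambda>|"
      using card_of_image ordLeq_transitive by blast
    then show ?case
      unfolding LS by (intro card_of_Un_ordLeq_infinite_Field) (use inf Suc in \<open>auto simp: card_of_card_order_on Field_card_of\<close>)
  qed
  moreover have "|UNIV :: nat set| \<le>o |\<Lambda>|" using inf infinite_iff_card_of_nat by blast
  ultimately have card: "|\<Union>n. L n| \<le>o |\<Lambda>|" using card_of_UNION_ordLeq_infinite[OF inf] by blast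
  have mono: "L n \<subseteq> L (n + m)" for n m
    by (induction m) (use LS in auto)
  have "x \<in> (\<Union>n. L n)" if "x \<in> generated X P F" for x
    using that
  proof induction
    case (base x)
    then show ?case using L0 by blast
  next
    case (step p xs)
    \<comment> \<open>One operation has finitely many arguments and the stages increase, so the
      arguments all lie in one \<open>L N\<close>.\<close>
    have "\<exists>N. set xs \<subseteq> L N" if "\<forall>x\<in>set xs. x \<in> (\<Union>n. L n)" for xs
      using that
    proof (induction xs)
      case (Cons y ys)
      then obtain N n where "set ys \<subseteq> L N" "y \<in> L n" by auto
      then have "set (y # ys) \<subseteq> L (N + n)" using mono[of N n] mono[of n N] by (auto simp: add.commute)
      then show ?case by blast
    qed simp
    then obtain N where "set xs \<subseteq> L N" using step by blast
    then have "F p xs \<in> L (Suc N)" unfolding LS using step(1) by (auto simp: image_iff)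
    then show ?case by blast
  qed
  then have "generated X P F \<subseteq> (\<Union>n. L n)" by blast
  then show ?thesis using card card_of_mono1 ordLeq_transitive by blast
qed

text \<open>Only well-formed formulas are counted, because the types \<open>'f\<close> and
  \<open>'r\<close> may be much larger than the language.\<close>

definition formulas :: "('f, 'r, 'm) struct \<Rightarrow> ('f, 'r) fm set" where
  "formulas S = {\<phi>. \<exists>n. wf_fm S n \<phi>}"

lemma card_of_formulas_ordLeq:
  fixes S :: "('f, 'r, 'm) struct"
  assumes inf: "\<not> finite (\<Lambda> :: 'l set)" and fs: "|funs S| \<le>o |\<Lambda>|" and rs: "|rels S| \<le>o |\<Lambda>|"
  shows "|formulas S| \<le>o |\<Lambda>|"
proof -
  have nat: "|UNIV :: nat set| \<le>o |\<Lambda>|" using inf infinite_iff_card_of_nat by blast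
  define T where "T = generated (range Var) (funs S) App"
  have "|range Var :: 'f tm set| \<le>o |\<Lambda>|" using nat card_of_image ordLeq_transitive by blast
  then have cT: "|T| \<le>o |\<Lambda>|" unfolding T_def by (intro card_of_generated_ordLeq inf fs)
  have T: "t \<in> T" if "wf_tm S n t" for n t
    using that
  proof (induction t)
    case (Var k)
    then show ?case unfolding T_def by (intro generated.base) simp
  next
    case (App f ts)
    then show ?case unfolding T_def by (intro generated.step) auto
  qed
  define A :: "('f, 'r) fm set" where
    "A = (\<lambda>(t, u). Equal t u) ` (T \<times> T) \<union> (\<lambda>(r, ts). Rel r ts) ` (rels S \<times> lists T)"
  \<comment> \<open>The connectives become operations on lists: index 0 is \<open>Neg\<close>, 1 is
    \<open>And\<close>, every other index is \<open>Ex\<close>; \<open>hd\<close> and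
    \<open>last\<close> recover the arguments.\<close>
  define G :: "nat \<Rightarrow> ('f, 'r) fm list \<Rightarrow> ('f, 'r) fm" where
    "G = (\<lambda>k \<phi>s. if k = 0 then Neg (hd \<phi>s) else if k = 1 then And (hd \<phi>s) (last \<phi>s) else Ex (hd \<phi>s))"
  have "|T \<times> T| \<le>o |\<Lambda>|"
    using card_of_Sigma_ordLeq_infinite[OF inf cT, of "\<lambda>_. T"] cT by simp
  then have 1: "|(\<lambda>(t, u). Equal t u :: ('f, 'r) fm) ` (T \<times> T)| \<le>o |\<Lambda>|"
    using card_of_image ordLeq_transitive by blast
  have "|rels S \<times> lists T| \<le>o |\<Lambda>|"
    using card_of_Sigma_ordLeq_infinite[OF inf rs, of "\<lambda>_. lists T"]
      card_of_lists_ordLeq[OF inf cT] by simp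
  then have 2: "|(\<lambda>(r, ts). Rel r ts) ` (rels S \<times> lists T)| \<le>o |\<Lambda>|"
    using card_of_image ordLeq_transitive by blast
  have "|A| \<le>o |\<Lambda>|"
    unfolding A_def by (intro card_of_Un_ordLeq_infinite_Field) (use inf 1 2 in \<open>auto simp: card_of_card_order_on Field_card_of\<close>)
  then have card: "|generated A (UNIV :: nat set) G| \<le>o |\<Lambda>|"
    by (rule card_of_generated_ordLeq[OF inf _ nat])
  have "\<phi> \<in> generated A UNIV G" if "wf_fm S n \<phi>" for n \<phi>
    using that
  proof (induction \<phi> arbitrary: n)
    case (Equal t u)
    then have "Equal t u \<in> A" using T unfolding A_def by (auto simp: image_iff)
    then show ?case by (rule generated.base)
  next
    case (Rel r ts)
    then have "ts \<in> lists T" using T by auto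
    then have "Rel r ts \<in> A" using Rel unfolding A_def by (auto simp: image_iff)
    then show ?case by (rule generated.base)
  next
    case (Neg \<phi>)
    then show ?case using generated.step[of 0 UNIV "[\<phi>]" A G] by (simp add: G_def)
  next
    case (And \<phi> \<psi>)
    then show ?case using generated.step[of 1 UNIV "[\<phi>, \<psi>]" A G] by (auto simp: G_def)
  next
    case (Ex \<phi>)
    then show ?case using generated.step[of 2 UNIV "[\<phi>]" A G] by (simp add: G_def)
  qed
  then have "formulas S \<subseteq> generated A UNIV G" unfolding formulas_def by blast
  then show ?thesis using card card_of_mono1 ordLeq_transitive by blast
qed

text \<open>\<open>\<kappa>\<close> may be singular, so a union of small sets over a small index set
  is not bounded by \<open>\<kappa>\<close> directly; instead all sizes are compared with one
  infinite \<open>\<Lambda>\<close> below \<open>\<kappa>\<close>.\<close>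

lemma small_bound:
  fixes S :: "('f, 'r, 'm) struct" and X :: "'m set"
  assumes mon: "monster S \<kappa>" and X: "small \<kappa> X"
  obtains \<Lambda> :: "('m + 'f + 'r + nat) set"
  where "\<not> finite \<Lambda>" "|\<Lambda>| <o \<kappa>" "|X| \<le>o |\<Lambda>|" "|formulas S| \<le>o |\<Lambda>|"
proof
  let ?\<Lambda> = "X <+> funs S <+> rels S <+> (UNIV :: nat set)"
  have *: "\<not> finite (Field \<kappa>)" "Card_order \<kappa>" "natLeq <o \<kappa>" "|funs S| <o \<kappa>" "|rels S| <o \<kappa>"
    using mon monster_infinite unfolding monster_def by auto
  have "|UNIV :: nat set| <o \<kappa>"
    using *(3) card_of_nat ordIso_ordLess_trans by blast
  then show "|?\<Lambda>| <o \<kappa>"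
    using * X unfolding small_def by (intro card_of_Plus_ordLess_infinite_Field)
  show inf: "\<not> finite ?\<Lambda>" by (auto simp: finite_Plus_iff)
  show "|X| \<le>o |?\<Lambda>|" by (rule card_of_Plus1)
  have "|funs S| \<le>o |?\<Lambda>|" "|rels S| \<le>o |?\<Lambda>|"
    using card_of_Plus1 card_of_Plus2 ordLeq_transitive by meson+
  then show "|formulas S| \<le>o |?\<Lambda>|" by (rule card_of_formulas_ordLeq[OF inf])
qed

lemma small_UN_nat_finite:
  assumes "monster S \<kappa>" "\<And>i :: nat. finite (A i)"
  shows "small \<kappa> (\<Union>i. A i)"
proof -
  have "\<not> finite (UNIV :: nat set)" by simp
  moreover have "|A i| \<le>o |UNIV :: nat set|" for i
    using assms(2)[of i] by (intro finite_ordLeq_infinite) auto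
  ultimately have "|\<Union>i. A i| \<le>o |UNIV :: nat set|"
    by (intro card_of_UNION_ordLeq_infinite) (auto simp: card_of_refl ordIso_imp_ordLeq)
  moreover have "|UNIV :: nat set| <o \<kappa>"
    using assms(1) card_of_nat ordIso_ordLess_trans unfolding monster_def by blast
  ultimately show ?thesis unfolding small_def using ordLeq_ordLess_trans by blast
qed

text \<open>This is the Tarski-Vaught test.\<close>

lemma elem_substruct_if_witnesses:
  fixes S :: "('f, 'r, 'm) struct"
  assumes ne: "M \<noteq> {}"
    and wit: "\<And>\<phi> e. \<lbrakk>set e \<subseteq> M; wf_fm S (Suc (length e)) \<phi>; \<exists>m. holds S (m # e) \<phi>\<rbrakk>
      \<Longrightarrow> \<exists>m\<in>M. holds S (m # e) \<phi>"
  shows "elem_substruct S M"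
proof -
  have "sat S M e \<phi> \<longleftrightarrow> holds S e \<phi>" if "set e \<subseteq> M" "wf_fm S (length e) \<phi>" for e \<phi>
    using that
  proof (induction \<phi> arbitrary: e)
    case (Ex \<phi>)
    have "sat S M (m # e) \<phi> \<longleftrightarrow> holds S (m # e) \<phi>" if "m \<in> M" for m
      using Ex.IH[of "m # e"] Ex.prems that by simp
    then show ?case using wit[of e \<phi>] Ex.prems by auto
  qed auto
  moreover have "fun_int S f xs \<in> M" if "f \<in> funs S" "length xs = fun_ar S f" "set xs \<subseteq> M" for f xs
  proof -
    \<comment> \<open>Closure under \<open>f\<close> is the test applied to the formula saying that
      \<open>x\<close> is the value of \<open>f\<close> at \<open>xs\<close>.\<close>
    define \<phi> :: "('f, 'r) fm" where "\<phi> = Equal (Var 0) (App f (map (\<lambda>i. Var (Suc i)) [0..<length xs]))"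
    have *: "map (eval S (m # xs) \<circ> (\<lambda>i. Var (Suc i))) [0..<length xs] = xs" for m
      by (rule nth_equalityI) auto
    have "holds S (m # xs) \<phi> \<longleftrightarrow> m = fun_int S f xs" for m
      unfolding \<phi>_def using *[of m] by simp
    moreover have "wf_fm S (Suc (length xs)) \<phi>" using that by (auto simp: \<phi>_def)
    ultimately show ?thesis using wit[of xs \<phi>] that(3) by auto
  qed
  ultimately show ?thesis using ne unfolding elem_substruct_def by blast
qed

text \<open>Downward Lowenheim-Skolem: \<open>M\<close> is the closure of \<open>X\<close> under
  chosen witnesses, with one operation for each formula.\<close>

lemma small_model_exists:
  fixes S :: "('f, 'r, 'm) struct"
  assumes mon: "monster S \<kappa>" and X: "small \<kappa> X"
  obtains M where "small_model S \<kappa> M" "X \<subseteq> M"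
proof -
  \<comment> \<open>The extra element \<open>undefined\<close> keeps the model nonempty when
    \<open>X\<close> is empty.\<close>
  have "small \<kappa> (insert undefined X)"
    using small_Un[OF mon small_finite[OF mon, of "{undefined}"] X] by simp
  then obtain \<Lambda> :: "('m + 'f + 'r + nat) set" where \<Lambda>: "\<not> finite \<Lambda>" "|\<Lambda>| <o \<kappa>"
    "|insert undefined X| \<le>o |\<Lambda>|" "|formulas S| \<le>o |\<Lambda>|"
    using small_bound[OF mon] by metis
  define F where "F = (\<lambda>\<phi> e. SOME m. holds S (m # e) \<phi>)"
  define M where "M = generated (insert undefined X) (formulas S) F"
  have "|M| \<le>o |\<Lambda>|" unfolding M_def by (rule card_of_generated_ordLeq[OF \<Lambda>(1,3,4)])
  then have "small \<kappa> M" unfolding small_def using \<Lambda>(2) ordLeq_ordLess_trans by blast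
  moreover have "X \<subseteq> M" unfolding M_def by (auto intro: generated.base)
  moreover have "elem_substruct S M"
  proof (rule elem_substruct_if_witnesses)
    have "undefined \<in> M" unfolding M_def by (rule generated.base) simp
    then show "M \<noteq> {}" by blast
    fix \<phi> e assume *: "set e \<subseteq> M" "wf_fm S (Suc (length e)) \<phi>" "\<exists>m. holds S (m # e) \<phi>"
    have "F \<phi> e \<in> M"
      unfolding M_def by (rule generated.step) (use * in \<open>auto simp: formulas_def M_def\<close>)
    moreover have "holds S (F \<phi> e # e) \<phi>" unfolding F_def using *(3) by (rule someI_ex)
    ultimately show "\<exists>m\<in>M. holds S (m # e) \<phi>" by blast
  qed
  ultimately show ?thesis using that unfolding small_model_def by blast
qed

section \<open>Algebraic closure\<close>

lemma acl_mono: "A \<subseteq> B \<Longrightarrow> acl S A \<subseteq> acl S B"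
  unfolding acl_def by blast

lemma subset_acl: "A \<subseteq> acl S A"
proof
  fix a assume "a \<in> A"
  then show "a \<in> acl S A"
    unfolding acl_def
    by (intro CollectI exI[of _ "Equal (Var 0) (Var 1)"] exI[of _ "[a]"]) simp
qed

lemma acl_definable:
  assumes "definable S A 1 P" "P [m]" "finite {x. P [x]}"
  shows "m \<in> acl S A"
proof -
  obtain \<phi> bs where p: "set bs \<subseteq> A" "wf_fm S (1 + length bs) \<phi>"
    "\<forall>xs. length xs = 1 \<longrightarrow> (P xs \<longleftrightarrow> holds S (xs @ bs) \<phi>)"
    using assms(1) unfolding definable_def by blast
  have "P [x] \<longleftrightarrow> holds S (x # bs) \<phi>" for x using p(3)[rule_format, of "[x]"] by simp
  then show ?thesis using p(1,2) assms(2,3) unfolding acl_def by auto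
qed

lemma small_acl:
  fixes S :: "('f, 'r, 'm) struct"
  assumes mon: "monster S \<kappa>" and A: "small \<kappa> A"
  shows "small \<kappa> (acl S A)"
proof -
  obtain \<Lambda> :: "('m + 'f + 'r + nat) set" where \<Lambda>: "\<not> finite \<Lambda>" "|\<Lambda>| <o \<kappa>"
    "|A| \<le>o |\<Lambda>|" "|formulas S| \<le>o |\<Lambda>|"
    using small_bound[OF mon A] by metis
  \<comment> \<open>Infinite solution sets are replaced by the empty set, so every
    \<open>roots z\<close> is finite and the union over at most \<open>|\<Lambda>|\<close> pairs
    stays within \<open>|\<Lambda>|\<close>.\<close>
  define roots where "roots = (\<lambda>(\<phi>, e). if finite {x. holds S (x # e) \<phi>} then {x. holds S (x # e) \<phi>} else {})"
  have "acl S A \<subseteq> (\<Union>z\<in>formulas S \<times> lists A. roots z)"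
  proof
    fix m assume "m \<in> acl S A"
    then obtain \<phi> e where *: "set e \<subseteq> A" "wf_fm S (Suc (length e)) \<phi>" "holds S (m # e) \<phi>"
      "finite {x. holds S (x # e) \<phi>}" unfolding acl_def by blast
    then have "(\<phi>, e) \<in> formulas S \<times> lists A" by (auto simp: formulas_def)
    moreover have "m \<in> roots (\<phi>, e)" using * by (simp add: roots_def)
    ultimately show "m \<in> (\<Union>z\<in>formulas S \<times> lists A. roots z)" by blast
  qed
  moreover have "|\<Union>z\<in>formulas S \<times> lists A. roots z| \<le>o |\<Lambda>|"
  proof (rule card_of_UNION_ordLeq_infinite[OF \<Lambda>(1)])
    show "|formulas S \<times> lists A| \<le>o |\<Lambda>|"
      using card_of_Sigma_ordLeq_infinite[OF \<Lambda>(1,4), of "\<lambda>_. lists A"]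
        card_of_lists_ordLeq[OF \<Lambda>(1,3)] by simp
    have "finite (roots z)" for z by (simp add: roots_def split: prod.split)
    then have "|roots z| \<le>o |\<Lambda>|" for z
      using \<Lambda>(1) finite_ordLeq_infinite by blast
    then show "\<forall>z\<in>formulas S \<times> lists A. |roots z| \<le>o |\<Lambda>|" by blast
  qed
  ultimately show ?thesis
    unfolding small_def using \<Lambda>(2) card_of_mono1 ordLeq_transitive ordLeq_ordLess_trans by meson
qed

lemma solutions_automorphism:
  assumes "automorphism S \<sigma>" "wf_fm S (Suc (length e)) \<phi>"
  shows "{x. holds S (x # map \<sigma> e) \<phi>} = \<sigma> ` {x. holds S (x # e) \<phi>}"
proof -
  have "holds S (\<sigma> x # map \<sigma> e) \<phi> \<longleftrightarrow> holds S (x # e) \<phi>" for x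
    using holds_automorphism[OF assms(1), of "x # e" \<phi>] assms(2) by simp
  moreover have "\<exists>y. x = \<sigma> y" for x
    using assms(1) unfolding automorphism_def by (metis bij_pointE)
  ultimately show ?thesis by (auto simp: image_iff) metis
qed

lemma acl_automorphism:
  assumes "automorphism S \<sigma>"
  shows "\<sigma> m \<in> acl S (\<sigma> ` A) \<longleftrightarrow> m \<in> acl S A"
proof -
  have inj: "inj \<sigma>" using assms unfolding automorphism_def bij_def by blast
  have fin: "finite {x. holds S (x # map \<sigma> e) \<phi>} \<longleftrightarrow> finite {x. holds S (x # e) \<phi>}"
    if "wf_fm S (Suc (length e)) \<phi>" for e \<phi>
    unfolding solutions_automorphism[OF assms that]
    by (rule finite_image_iff) (use inj in \<open>simp add: inj_on_def\<close>)
  have h: "holds S (\<sigma> m # map \<sigma> e) \<phi> \<longleftrightarrow> holds S (m # e) \<phi>"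
    if "wf_fm S (Suc (length e)) \<phi>" for e \<phi>
    using holds_automorphism[OF assms, of "m # e" \<phi>] that by simp
  show ?thesis
  proof
    assume "\<sigma> m \<in> acl S (\<sigma> ` A)"
    then obtain \<phi> e' where e': "set e' \<subseteq> \<sigma> ` A" "wf_fm S (Suc (length e')) \<phi>"
      "holds S (\<sigma> m # e') \<phi>" "finite {x. holds S (x # e') \<phi>}" unfolding acl_def by blast
    then obtain e where e: "set e \<subseteq> A" "e' = map \<sigma> e"
      by (metis (no_types, lifting) in_lists_conv_set lists_image imageE subset_code(1))
    have wf: "wf_fm S (Suc (length e)) \<phi>" using e'(2) e(2) by simp
    show "m \<in> acl S A"
      unfolding acl_def using e(1) wf e'(3,4) h[OF wf] fin[OF wf] e(2) by blast
  next
    assume "m \<in> acl S A"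
    then obtain \<phi> e where e: "set e \<subseteq> A" "wf_fm S (Suc (length e)) \<phi>"
      "holds S (m # e) \<phi>" "finite {x. holds S (x # e) \<phi>}" unfolding acl_def by blast
    have "set (map \<sigma> e) \<subseteq> \<sigma> ` A" using e(1) by auto
    moreover have "wf_fm S (Suc (length (map \<sigma> e))) \<phi>" using e(2) by simp
    ultimately show "\<sigma> m \<in> acl S (\<sigma> ` A)"
      unfolding acl_def using e(3,4) h[OF e(2)] fin[OF e(2)] by blast
  qed
qed

section \<open>Algebraicity as finiteness of orbits under the pointwise stabilizer Aut(S/A)\<close>

definition fixing_automorphisms :: "('f, 'r, 'm) struct \<Rightarrow> 'm set \<Rightarrow> ('m \<Rightarrow> 'm) set" where
  "fixing_automorphisms S A = {\<sigma>. automorphism S \<sigma> \<and> (\<forall>a\<in>A. \<sigma> a = a)}"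

text \<open>The orbit stays inside the finite solution set of the formula that witnesses
  algebraicity.\<close>

lemma finite_orbit_if_acl:
  assumes "m \<in> acl S A"
  shows "finite ((\<lambda>\<sigma>. \<sigma> m) ` fixing_automorphisms S A)"
proof -
  obtain \<phi> e where e: "set e \<subseteq> A" "wf_fm S (Suc (length e)) \<phi>"
    "holds S (m # e) \<phi>" "finite {x. holds S (x # e) \<phi>}" using assms unfolding acl_def by blast
  have "holds S (\<sigma> m # e) \<phi>" if "\<sigma> \<in> fixing_automorphisms S A" for \<sigma>
  proof -
    have "map \<sigma> e = e" using that e(1) by (auto simp: fixing_automorphisms_def intro: map_idI)
    then show ?thesis
      using holds_automorphism[of S \<sigma> "m # e" \<phi>] that e(2,3) by (simp add: fixing_automorphisms_def)
  qed
  then show ?thesis by (intro finite_subset[OF _ e(4)]) blast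
qed

lemma finite_list_orbit_if_acl:
  assumes "set e \<subseteq> acl S A"
  shows "finite ((\<lambda>\<sigma>. map \<sigma> e) ` fixing_automorphisms S A)"
proof (rule finite_subset)
  define Orb where "Orb = (\<Union>m\<in>set e. (\<lambda>\<sigma>. \<sigma> m) ` fixing_automorphisms S A)"
  have "finite Orb"
    unfolding Orb_def
  proof (rule finite_UN_I)
    fix m assume "m \<in> set e"
    then have "m \<in> acl S A" using assms by blast
    then show "finite ((\<lambda>\<sigma>. \<sigma> m) ` fixing_automorphisms S A)" by (rule finite_orbit_if_acl)
  qed simp
  then show "finite {xs. set xs \<subseteq> Orb \<and> length xs = length e}" by (rule finite_lists_length_eq)
  show "(\<lambda>\<sigma>. map \<sigma> e) ` fixing_automorphisms S A \<subseteq> {xs. set xs \<subseteq> Orb \<and> length xs = length e}"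
  proof
    fix xs assume "xs \<in> (\<lambda>\<sigma>. map \<sigma> e) ` fixing_automorphisms S A"
    then obtain \<sigma> where \<sigma>: "\<sigma> \<in> fixing_automorphisms S A" "xs = map \<sigma> e" by blast
    have "\<sigma> m \<in> Orb" if "m \<in> set e" for m
      unfolding Orb_def by (rule UN_I[OF that imageI[OF \<sigma>(1)]])
    then show "xs \<in> {xs. set xs \<subseteq> Orb \<and> length xs = length e}" using \<sigma>(2) by auto
  qed
qed

text \<open>If \<open>m\<close> is not algebraic, saturation realizes tp(m/A) outside the finite
  orbit, while homogeneity places every realization inside it.\<close>

lemma acl_if_finite_orbit:
  assumes mon: "monster S \<kappa>" and A: "small \<kappa> A"
    and fin: "finite ((\<lambda>\<sigma>. \<sigma> m) ` fixing_automorphisms S A)"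
  shows "m \<in> acl S A"
proof (rule ccontr)
  assume m: "m \<notin> acl S A"
  define Orb where "Orb = (\<lambda>\<sigma>. \<sigma> m) ` fixing_automorphisms S A"
  have finO: "finite Orb" unfolding Orb_def by (rule fin)
  \<comment> \<open>\<open>\<T>\<close> is tp(m/A) as a family of sets of lists; \<open>\<N>\<close>
    says that the realization avoids the orbit.\<close>
  define \<T> where "\<T> = {D. definable S A 1 (\<lambda>xs. xs \<in> D) \<and> [m] \<in> D}"
  define \<N> where "\<N> = (\<lambda>c. {xs :: 'c list. hd xs \<noteq> c}) ` Orb"
  have "\<exists>xs. length xs = 1 \<and> (\<forall>D \<in> \<T> \<union> \<N>. xs \<in> D)"
  proof (rule saturated_n[OF mon])
    show "small \<kappa> (A \<union> Orb)" by (rule small_Un[OF mon A small_finite[OF mon finO]])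
  next
    fix D assume "D \<in> \<T> \<union> \<N>"
    then show "definable S (A \<union> Orb) 1 (\<lambda>xs. xs \<in> D)"
    proof
      assume "D \<in> \<T>"
      then show ?thesis unfolding \<T>_def by (blast intro: definable_mono)
    next
      assume "D \<in> \<N>"
      then obtain c where "c \<in> Orb" "D = {xs. hd xs \<noteq> c}" unfolding \<N>_def by blast
      then show ?thesis using definable_not[OF definable_eq_const[of c "A \<union> Orb" S]] by simp
    qed
  next
    fix q assume q: "q \<subseteq> \<T> \<union> \<N>" "finite q"
    have 1: "definable S A 1 (\<lambda>xs. \<forall>D\<in>q \<inter> \<T>. xs \<in> D)"
      by (rule definable_Ball) (use q(2) in \<open>auto simp: \<T>_def\<close>)
    have 2: "\<forall>D\<in>q \<inter> \<T>. [m] \<in> D" by (auto simp: \<T>_def)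
    \<comment> \<open>A finite part of tp(m/A) amounts to one formula over \<open>A\<close>; it
      holds of the nonalgebraic \<open>m\<close>, so its solutions cannot all lie in the finite
      orbit.\<close>
    have "infinite {x. \<forall>D\<in>q \<inter> \<T>. [x] \<in> D}"
      using acl_definable[OF 1 2] m by (rule contrapos_nn[rotated])
    then have "\<not> {x. \<forall>D\<in>q \<inter> \<T>. [x] \<in> D} \<subseteq> Orb" using finO finite_subset by blast
    then obtain x where "\<forall>D\<in>q \<inter> \<T>. [x] \<in> D" "x \<notin> Orb" by blast
    moreover have "[x] \<in> D" if D: "D \<in> \<N>" for D
    proof -
      obtain c where c: "c \<in> Orb" "D = {xs. hd xs \<noteq> c}" using D unfolding \<N>_def by blast
      then show ?thesis using \<open>x \<notin> Orb\<close> by auto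
    qed
    ultimately have "\<forall>D\<in>q. [x] \<in> D" using q(1) by blast
    then show "\<exists>xs. length xs = 1 \<and> (\<forall>D\<in>q. xs \<in> D)" by (intro exI[of _ "[x]"]) simp
  qed
  then obtain xs where xs: "length xs = 1" "\<forall>D \<in> \<T> \<union> \<N>. xs \<in> D" by blast
  then obtain x where x: "xs = [x]" by (auto simp: length_Suc_conv)
  have "list_tp_eq S A [m] [x]"
  proof (rule list_tp_eqI)
    fix P assume P: "definable S A (length [m]) P"
    have "Q [x]" if "definable S A 1 Q" "Q [m]" for Q
    proof -
      have "{xs. Q xs} \<in> \<T>" using that unfolding \<T>_def by simp
      then show ?thesis using xs(2) x by blast
    qed
    note * = this
    have P: "definable S A 1 P" using P by simp
    show "P [m] \<longleftrightarrow> P [x]" using *[OF P] *[OF definable_not[OF P]] by blast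
  qed simp
  then obtain \<sigma> where "automorphism S \<sigma>" "\<forall>a\<in>A. \<sigma> a = a" "map \<sigma> [m] = [x]"
    by (rule list_tp_eq_automorphism[OF mon A])
  then have "x \<in> Orb" unfolding Orb_def by (intro image_eqI[of _ _ \<sigma>]) (auto simp: fixing_automorphisms_def)
  then have "{xs. hd xs \<noteq> x} \<in> \<N>" unfolding \<N>_def by blast
  from bspec[OF xs(2) UnI2[OF this]] have "xs \<in> {xs. hd xs \<noteq> x}" .
  then show False using x by simp
qed

text \<open>By orbits: \<open>e\<close> has finitely many conjugates over \<open>A\<close>, each
  conjugate of the formula has finitely many solutions, and every conjugate of \<open>m\<close> is
  among them.\<close>

lemma acl_acl:
  assumes mon: "monster S \<kappa>" and A: "small \<kappa> A"
  shows "acl S (acl S A) = acl S A"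
proof (rule equalityI[OF subsetI subset_acl])
  fix m assume "m \<in> acl S (acl S A)"
  then obtain \<phi> e where e: "set e \<subseteq> acl S A" "wf_fm S (Suc (length e)) \<phi>"
    "holds S (m # e) \<phi>" "finite {x. holds S (x # e) \<phi>}" unfolding acl_def[of S "acl S A"] by blast
  let ?E = "(\<lambda>\<sigma>. map \<sigma> e) ` fixing_automorphisms S A"
  have "finite (\<Union>e'\<in>?E. {x. holds S (x # e') \<phi>})"
  proof (rule finite_UN_I[OF finite_list_orbit_if_acl[OF e(1)]])
    fix e' assume "e' \<in> ?E"
    then obtain \<sigma> where "automorphism S \<sigma>" "e' = map \<sigma> e" by (auto simp: fixing_automorphisms_def)
    then show "finite {x. holds S (x # e') \<phi>}"
      using solutions_automorphism[OF _ e(2)] e(4) by simp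
  qed
  moreover have "(\<lambda>\<sigma>. \<sigma> m) ` fixing_automorphisms S A \<subseteq> (\<Union>e'\<in>?E. {x. holds S (x # e') \<phi>})"
    using holds_automorphism[of S _ "m # e" \<phi>] e(2,3) by (auto simp: fixing_automorphisms_def)
  ultimately show "m \<in> acl S A"
    by (intro acl_if_finite_orbit[OF mon A]) (rule finite_subset)
qed

section \<open>Dividing and forking\<close>

lemma fm_divides_mono: "\<lbrakk>fm_divides S C' n \<phi> b; C \<subseteq> C'\<rbrakk> \<Longrightarrow> fm_divides S C n \<phi> b"
  unfolding fm_divides_def using list_tp_eq_mono by metis

text \<open>The same sequence witnesses dividing over the smaller \<open>C\<close>, and over the
  larger \<open>B\<close> there are fewer realizations to check.\<close>

lemma tp_divides_mono:
  assumes "tp_divides S A B' C'" "B' \<subseteq> B" "C \<subseteq> C'"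
  shows "tp_divides S A B C"
proof -
  obtain as \<phi> b where *: "set as \<subseteq> A" "fm_divides S C' (length as) \<phi> b"
    "\<And>f. realizes S B' A f \<Longrightarrow> holds S (map f as @ b) \<phi>"
    using assms(1) unfolding tp_divides_def by blast
  have "holds S (map f as @ b) \<phi>" if "realizes S B A f" for f
    by (rule *(3)[OF tp_eq_mono[OF that assms(2) subset_refl]])
  then show ?thesis
    unfolding tp_divides_def using *(1) fm_divides_mono[OF *(2) assms(3)] by blast
qed

lemma ind_M_if_ind_da:
  assumes mon: "monster S \<kappa>" and imp: "rel_implies \<kappa> (ind_da S) R"
    and small: "small \<kappa> A" "small \<kappa> B" "small \<kappa> C" and ind: "ind_da S A C B"
  shows "ind_M S R A C B"
  unfolding ind_M_def
proof (intro allI impI, elim conjE)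
  fix D assume D: "C \<subseteq> D" "D \<subseteq> acl S (B \<union> C)"
  have BC: "small \<kappa> (B \<union> C)" by (rule small_Un[OF mon small(2,3)])
  have "small \<kappa> D" by (rule small_subset[OF small_acl[OF mon BC] D(2)])
  moreover have "ind_da S A D B"
    unfolding ind_da_def ind_d_def
  proof
    assume *: "tp_divides S A (acl S (B \<union> D) \<union> D) D"
    \<comment> \<open>Idempotence of \<open>acl\<close> keeps acl(BD) inside acl(BC), so dividing
      over \<open>D\<close> would give dividing over \<open>C\<close>.\<close>
    have "B \<union> D \<subseteq> acl S (B \<union> C)" using D(2) subset_acl[of "B \<union> C" S] by blast
    then have "acl S (B \<union> D) \<subseteq> acl S (B \<union> C)" using acl_mono acl_acl[OF mon BC] by metis
    then have "tp_divides S A (acl S (B \<union> C) \<union> C) C"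
      using D by (intro tp_divides_mono[OF *]) auto
    then show False using ind unfolding ind_da_def ind_d_def by blast
  qed
  ultimately show "R A D B" using imp small(1,2) unfolding rel_implies_def by blast
qed

text \<open>Compactness: otherwise tp(as/E) together with the negation of
  \<open>\<phi>(x, b)\<close> is finitely satisfiable, hence realized by some
  \<open>xs\<close>.\<close>

lemma implying_formula_exists:
  assumes mon: "monster S \<kappa>" and E: "small \<kappa> E"
    and wf: "wf_fm S (length as + length b) \<phi>"
    and imp: "\<And>f. realizes S E A f \<Longrightarrow> holds S (map f as @ b) \<phi>"
  obtains \<psi> d where "set d \<subseteq> E" "wf_fm S (length as + length d) \<psi>" "holds S (as @ d) \<psi>"
    "\<And>xs. \<lbrakk>length xs = length as; holds S (xs @ d) \<psi>\<rbrakk> \<Longrightarrow> holds S (xs @ b) \<phi>"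
proof (rule ccontr)
  assume no: "\<not> thesis"
  define \<T> where "\<T> = {D. definable S E (length as) (\<lambda>xs. xs \<in> D) \<and> as \<in> D}"
  define N where "N = {xs. \<not> holds S (xs @ b) \<phi>}"
  have "\<exists>xs. length xs = length as \<and> (\<forall>D \<in> insert N \<T>. xs \<in> D)"
  proof (rule saturated_n[OF mon])
    show "small \<kappa> (E \<union> set b)" by (rule small_Un[OF mon E small_finite[OF mon]]) simp
  next
    fix D assume "D \<in> insert N \<T>"
    moreover have "definable S (E \<union> set b) (length as) (\<lambda>xs. xs \<in> N)"
      unfolding N_def mem_Collect_eq by (rule definable_not[OF definable_formula[OF wf]]) simp
    ultimately show "definable S (E \<union> set b) (length as) (\<lambda>xs. xs \<in> D)"
      unfolding \<T>_def by (blast intro: definable_mono)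
  next
    fix q assume q: "q \<subseteq> insert N \<T>" "finite q"
    have "definable S E (length as) (\<lambda>xs. \<forall>D\<in>q \<inter> \<T>. xs \<in> D)"
      by (rule definable_Ball) (use q(2) in \<open>auto simp: \<T>_def\<close>)
    then obtain \<psi> d where \<psi>: "set d \<subseteq> E" "wf_fm S (length as + length d) \<psi>"
      "\<forall>xs. length xs = length as \<longrightarrow> ((\<forall>D\<in>q \<inter> \<T>. xs \<in> D) \<longleftrightarrow> holds S (xs @ d) \<psi>)"
      unfolding definable_def by blast
    have "holds S (as @ d) \<psi>" using \<psi>(3) by (auto simp: \<T>_def)
    then have "\<exists>xs. length xs = length as \<and> holds S (xs @ d) \<psi> \<and> \<not> holds S (xs @ b) \<phi>"
      using that[OF \<psi>(1,2)] no by blast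
    then obtain xs where "length xs = length as" "holds S (xs @ d) \<psi>" "xs \<in> N"
      unfolding N_def by blast
    then have "length xs = length as \<and> (\<forall>D\<in>q. xs \<in> D)" using \<psi>(3) q(1) by blast
    then show "\<exists>xs. length xs = length as \<and> (\<forall>D\<in>q. xs \<in> D)" by blast
  qed
  then obtain xs where xs: "length xs = length as" "xs \<in> N" "\<And>D. D \<in> \<T> \<Longrightarrow> xs \<in> D" by auto
  have "list_tp_eq S E as xs"
  proof (rule list_tp_eqI)
    fix P assume P: "definable S E (length as) P"
    have *: "Q xs" if "definable S E (length as) Q" "Q as" for Q
    proof -
      have "{xs. Q xs} \<in> \<T>" using that unfolding \<T>_def by simp
      from xs(3)[OF this] show ?thesis by simp
    qed
    show "P as \<longleftrightarrow> P xs" using *[OF P] *[OF definable_not[OF P]] by blast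
  qed (simp add: xs(1))
  \<comment> \<open>An automorphism over \<open>E\<close> taking \<open>as\<close> to
    \<open>xs\<close> gives a realization of tp(A/E) on all of \<open>A\<close>, not only on the
    entries of \<open>as\<close>.\<close>
  then obtain \<sigma> where \<sigma>: "automorphism S \<sigma>" "\<forall>a\<in>E. \<sigma> a = a" "map \<sigma> as = xs"
    by (rule list_tp_eq_automorphism[OF mon E])
  from imp[OF automorphism_realizes[OF \<sigma>(1,2)]] show False using xs(2) \<sigma>(3) by (simp add: N_def)
qed

text \<open>Automorphisms over \<open>C\<close> that move \<open>b\<close> to the
  \<open>bs i\<close> move \<open>d\<close> along. The conjugates of \<open>\<psi>(x, d)\<close>
  imply the \<open>\<phi>(x, bs i)\<close> and inherit their inconsistency.\<close>

lemma fm_divides_if_implies: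
  assumes mon: "monster S \<kappa>" and C: "small \<kappa> C" and div: "fm_divides S C n \<phi> b"
    and wf: "wf_fm S (n + length d) \<psi>"
    and imp: "\<And>xs. \<lbrakk>length xs = n; holds S (xs @ d) \<psi>\<rbrakk> \<Longrightarrow> holds S (xs @ b) \<phi>"
  shows "fm_divides S C n \<psi> d"
proof -
  obtain bs k where wf\<phi>: "wf_fm S (n + length b) \<phi>" and bs: "\<And>i :: nat. list_tp_eq S C (bs i) b"
    and inc: "\<And>J. \<lbrakk>finite J; card J = k\<rbrakk> \<Longrightarrow>
      \<not> (\<exists>xs. length xs = n \<and> (\<forall>i\<in>J. holds S (xs @ bs i) \<phi>))"
    using div unfolding fm_divides_def by blast
  have "\<exists>\<sigma>. automorphism S \<sigma> \<and> (\<forall>c\<in>C. \<sigma> c = c) \<and> map \<sigma> b = bs i" for i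
    by (rule list_tp_eq_automorphism[OF mon C list_tp_eq_sym[OF bs[of i]]]) blast
  then obtain \<sigma> where \<sigma>: "\<And>i. automorphism S (\<sigma> i)" "\<And>i. \<forall>c\<in>C. \<sigma> i c = c"
    "\<And>i. map (\<sigma> i) b = bs i" by metis
  have imp': "holds S (xs @ bs i) \<phi>" if xs: "length xs = n" "holds S (xs @ map (\<sigma> i) d) \<psi>" for xs i
  proof -
    \<comment> \<open>Surjectivity pulls \<open>xs\<close> back to a tuple \<open>zs\<close>, where
      the implication between the original formulas applies.\<close>
    have "surj (\<sigma> i)" using \<sigma>(1)[of i] unfolding automorphism_def bij_def by blast
    then obtain zs where zs: "xs = map (\<sigma> i) zs" by (metis ex_map_conv surjD)
    then have "holds S (zs @ d) \<psi>"
      using holds_automorphism[OF \<sigma>(1)[of i], of "zs @ d" \<psi>] xs wf by simp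
    then have "holds S (zs @ b) \<phi>" using imp zs xs(1) by simp
    then show ?thesis
      using holds_automorphism[OF \<sigma>(1)[of i], of "zs @ b" \<phi>] xs wf\<phi> zs \<sigma>(3)[of i] by simp
  qed
  have tp: "list_tp_eq S C (map (\<sigma> i) d) d" for i
    by (rule list_tp_eq_sym[OF automorphism_list_tp_eq[OF \<sigma>(1,2)]])
  show ?thesis
    unfolding fm_divides_def
  proof (intro conjI wf exI[of _ "\<lambda>i. map (\<sigma> i) d"] exI[of _ k] allI impI tp notI)
    fix J assume J: "finite J \<and> card J = k"
      and "\<exists>xs. length xs = n \<and> (\<forall>i\<in>J. holds S (xs @ map (\<sigma> i) d) \<psi>)"
    then obtain xs where "length xs = n" "\<forall>i\<in>J. holds S (xs @ map (\<sigma> i) d) \<psi>" by blast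
    then have "\<forall>i\<in>J. holds S (xs @ bs i) \<phi>" using imp' by blast
    then show False using inc[of J] J \<open>length xs = n\<close> by blast
  qed
qed

lemma fm_divides_conjugate:
  assumes div: "fm_divides S C n \<phi> b" and eq: "list_tp_eq S C b b'"
  shows "fm_divides S C n \<phi> b'"
proof -
  have "length b' = length b" using list_tp_eq_length[OF eq] by simp
  then show ?thesis
    using div list_tp_eq_trans[OF _ eq] unfolding fm_divides_def by metis
qed

lemma ind_da_if_ind_f:
  assumes mon: "monster S \<kappa>" and small: "small \<kappa> A" "small \<kappa> B" "small \<kappa> C"
    and ind: "ind_f S A C B"
  shows "ind_da S A C B"
  unfolding ind_da_def ind_d_def
proof
  let ?E = "acl S (B \<union> C) \<union> C"
  assume "tp_divides S A ?E C"
  then obtain as \<phi> b where div: "set as \<subseteq> A" "fm_divides S C (length as) \<phi> b"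
    "\<And>f. realizes S ?E A f \<Longrightarrow> holds S (map f as @ b) \<phi>"
    unfolding tp_divides_def by blast
  have BC: "small \<kappa> (B \<union> C)" by (rule small_Un[OF mon small(2,3)])
  have E: "?E = acl S (B \<union> C)" using subset_acl[of "B \<union> C" S] by blast
  have wf: "wf_fm S (length as + length b) \<phi>" using div(2) unfolding fm_divides_def by blast
  obtain \<psi> d where \<psi>: "set d \<subseteq> acl S (B \<union> C)" "wf_fm S (length as + length d) \<psi>" "holds S (as @ d) \<psi>"
    "\<And>xs. \<lbrakk>length xs = length as; holds S (xs @ d) \<psi>\<rbrakk> \<Longrightarrow> holds S (xs @ b) \<phi>"
    using implying_formula_exists[OF mon small_acl[OF mon BC] wf div(3)[unfolded E]] by metis
  have div\<psi>: "fm_divides S C (length as) \<psi> d"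
    by (rule fm_divides_if_implies[OF mon small(3) div(2) \<psi>(2,4)])
  \<comment> \<open>All conjugates of \<open>\<psi>(x, d)\<close> over BC: finitely many because
    \<open>d\<close> is algebraic, and each divides over \<open>C\<close> because the automorphisms
    fix \<open>C\<close>.\<close>
  define \<Phi> where "\<Phi> = (\<lambda>d'. (as, \<psi>, d')) ` (\<lambda>\<sigma>. map \<sigma> d) ` fixing_automorphisms S (B \<union> C)"
  have "finite \<Phi>" unfolding \<Phi>_def by (intro finite_imageI finite_list_orbit_if_acl[OF \<psi>(1)])
  moreover have "set as' \<subseteq> A \<and> fm_divides S C (length as') \<psi>' d'" if in\<Phi>: "(as', \<psi>', d') \<in> \<Phi>" for as' \<psi>' d'
  proof -
    obtain \<sigma> where \<sigma>: "\<sigma> \<in> fixing_automorphisms S (B \<union> C)" "as' = as" "\<psi>' = \<psi>" "d' = map \<sigma> d"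
      using in\<Phi> unfolding \<Phi>_def by blast
    have "list_tp_eq S C d (map \<sigma> d)"
      using \<sigma>(1) by (intro automorphism_list_tp_eq) (auto simp: fixing_automorphisms_def)
    then show ?thesis using fm_divides_conjugate[OF div\<psi>] \<sigma> div(1) by simp
  qed
  moreover have "\<exists>(as', \<psi>', d')\<in>\<Phi>. holds S (map f as' @ d') \<psi>'" if f: "realizes S (B \<union> C) A f" for f
  proof -
    \<comment> \<open>A realization \<open>f\<close> of tp(A/BC) is induced by an automorphism
      \<open>\<sigma>\<close> over BC, so it satisfies the conjugate with parameters
      \<open>map \<sigma> d\<close>.\<close>
    have "small \<kappa> ((\<lambda>x. x) ` A)" using small(1) by simp
    then obtain \<sigma> where \<sigma>: "automorphism S \<sigma>" "\<forall>c\<in>B \<union> C. \<sigma> c = c" "\<forall>a\<in>A. \<sigma> a = f a"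
      by (rule extend_to_automorphism[OF mon BC _ f])
    have "holds S (map \<sigma> as @ map \<sigma> d) \<psi>"
      using holds_automorphism[OF \<sigma>(1), of "as @ d" \<psi>] \<psi>(2,3) by simp
    moreover have "map \<sigma> as = map f as" using \<sigma>(3) div(1) by auto
    ultimately have "holds S (map f as @ map \<sigma> d) \<psi>" by simp
    moreover have "\<sigma> \<in> fixing_automorphisms S (B \<union> C)"
      using \<sigma>(1,2) by (simp add: fixing_automorphisms_def)
    then have "(as, \<psi>, map \<sigma> d) \<in> \<Phi>" unfolding \<Phi>_def by (intro imageI)
    ultimately show ?thesis by (intro bexI[of _ "(as, \<psi>, map \<sigma> d)"]) simp_all
  qed
  ultimately have "tp_forks S A (B \<union> C) C"
    unfolding tp_forks_def by (intro exI[of _ \<Phi>]) auto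
  then show False using ind unfolding ind_f_def by blast
qed

section \<open>Coheir sequences\<close>

text \<open>Smaller filters are finer, so an ultrafilter is a minimal proper filter below
  \<open>F\<close>, found by Zorn's lemma for the reversed order.\<close>

lemma ultrafilter_exists:
  fixes F :: "'a filter"
  assumes "F \<noteq> bot"
  obtains U where "U \<le> F" "U \<noteq> bot" "\<And>P. eventually P U \<or> eventually (\<lambda>x. \<not> P x) U"
proof -
  let ?A = "{G. G \<le> F \<and> G \<noteq> bot}"
  have "\<exists>m \<in> ?A. \<forall>a \<in> ?A. a \<le> m \<longrightarrow> a = m"
  proof (rule predicate_Zorn)
    show "partial_order_on ?A (relation_of (\<lambda>x y. y \<le> x) ?A)"
      by (rule partial_order_on_relation_ofI) auto
    fix \<C> assume \<C>: "\<C> \<in> Chains (relation_of (\<lambda>x y. y \<le> x) ?A)"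
    have sub: "\<C> \<subseteq> ?A" using Chains_relation_of[OF \<C>] .
    show "\<exists>u\<in>?A. \<forall>a\<in>\<C>. u \<le> a"
    proof (cases "\<C> = {}")
      case True
      then show ?thesis using assms by auto
    next
      case False
      \<comment> \<open>In a chain the infimum of a finite nonempty subfamily is a member, hence
        proper; this makes the infimum of the whole chain proper.\<close>
      have "Inf X \<in> X" if "finite X" "X \<noteq> {}" "X \<subseteq> \<C>" for X
        using that
      proof (induction X rule: finite_ne_induct)
        case (insert x X)
        then have "x \<le> Inf X \<or> Inf X \<le> x"
          using \<C> unfolding Chains_def relation_of_def by blast
        then show ?case using insert by (auto simp: inf_absorb1 inf_absorb2)
      qed simp
      moreover have "(top :: 'a filter) \<noteq> bot" using assms by (metis bot_unique top_greatest)
      ultimately have "Inf X \<noteq> bot" if "X \<subseteq> \<C>" "finite X" for X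
        using that sub by (cases "X = {}") auto
      then have "Inf \<C> \<noteq> bot" by (rule Inf_filter_not_bot)
      moreover obtain G where "G \<in> \<C>" using False by blast
      then have "Inf \<C> \<le> F" using sub by (intro Inf_lower2[of G]) auto
      ultimately show ?thesis using Inf_lower by blast
    qed
  qed
  then obtain U where U: "U \<le> F" "U \<noteq> bot" "\<And>G. \<lbrakk>G \<le> F; G \<noteq> bot; G \<le> U\<rbrakk> \<Longrightarrow> G = U" by blast
  have "eventually P U \<or> eventually (\<lambda>x. \<not> P x) U" for P
  proof (rule disjCI)
    \<comment> \<open>If the negation of \<open>P\<close> is not eventual, restricting
      \<open>U\<close> to \<open>P\<close> leaves a proper filter, which equals \<open>U\<close> by
      minimality.\<close>
    let ?G = "inf U (principal {x. P x})"
    assume "\<not> eventually (\<lambda>x. \<not> P x) U"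
    then have "?G \<noteq> bot" by (simp add: trivial_limit_def eventually_inf_principal)
    then have "?G = U" using U(1) by (intro U(3)) (auto intro: le_infI1)
    moreover have "eventually P ?G" by (simp add: eventually_inf_principal)
    ultimately show "eventually P U" by simp
  qed
  then show thesis using that U by blast
qed

text \<open>Finitely many formulas of the limit type hold together for \<open>U\<close>-almost all
  \<open>i\<close>, so some \<open>bs i\<close> satisfies them and saturation applies.\<close>

lemma limit_type_realized:
  assumes mon: "monster S \<kappa>" and X: "small \<kappa> X" and len: "\<And>i. length (bs i) = l"
    and U: "U \<noteq> bot" "\<And>P. eventually P U \<or> eventually (\<lambda>x. \<not> P x) U"
  shows "\<exists>y. length y = l \<and> (\<forall>P. definable S X l P \<longrightarrow> (P y \<longleftrightarrow> eventually (\<lambda>i. P (bs i)) U))"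
proof -
  define \<T> where "\<T> = {D. definable S X l (\<lambda>xs. xs \<in> D) \<and> eventually (\<lambda>i. bs i \<in> D) U}"
  have "\<exists>y. length y = l \<and> (\<forall>D\<in>\<T>. y \<in> D)"
  proof (rule saturated_n[OF mon X])
    show "definable S X l (\<lambda>xs. xs \<in> D)" if "D \<in> \<T>" for D
      using that unfolding \<T>_def by blast
    fix q assume q: "q \<subseteq> \<T>" "finite q"
    have "\<forall>D\<in>q. eventually (\<lambda>i. bs i \<in> D) U" using q(1) unfolding \<T>_def by blast
    then have "eventually (\<lambda>i. \<forall>D\<in>q. bs i \<in> D) U" using q(2) by (simp add: eventually_ball_finite)
    then obtain i where "\<forall>D\<in>q. bs i \<in> D" using eventually_happens'[OF U(1)] by blast
    then show "\<exists>xs. length xs = l \<and> (\<forall>D\<in>q. xs \<in> D)" using len by blast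
  qed
  then obtain y where y: "length y = l" "\<And>D. D \<in> \<T> \<Longrightarrow> y \<in> D" by blast
  have *: "Q y" if "definable S X l Q" "eventually (\<lambda>i. Q (bs i)) U" for Q
  proof -
    have "{xs. Q xs} \<in> \<T>" using that unfolding \<T>_def by simp
    from y(2)[OF this] show ?thesis by simp
  qed
  have "P y \<longleftrightarrow> eventually (\<lambda>i. P (bs i)) U" if P: "definable S X l P" for P
    using *[OF P] *[OF definable_not[OF P]] U(2)[of "\<lambda>i. P (bs i)"] by blast
  then show ?thesis using y(1) by blast
qed

lemma successive_choice:
  assumes mon: "monster S \<kappa>" and M: "small \<kappa> M" and ex: "\<And>X. small \<kappa> X \<Longrightarrow> \<exists>y. Q X y"
  shows "\<exists>ys :: nat \<Rightarrow> 'a list. \<forall>j<n. Q (M \<union> (\<Union>i<j. set (ys i))) (ys j)"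
proof (induction n)
  case (Suc n)
  then obtain ys :: "nat \<Rightarrow> 'a list" where ys: "\<forall>j<n. Q (M \<union> (\<Union>i<j. set (ys i))) (ys j)" by blast
  have "small \<kappa> (M \<union> (\<Union>i<n. set (ys i)))"
    by (rule small_Un[OF mon M small_finite[OF mon]]) simp
  then obtain y where y: "Q (M \<union> (\<Union>i<n. set (ys i))) y" using ex by blast
  have "Q (M \<union> (\<Union>i<j. set ((ys(n := y)) i))) ((ys(n := y)) j)" if "j < Suc n" for j
  proof -
    have "(\<Union>i<j. set ((ys(n := y)) i)) = (\<Union>i<j. set (ys i))" using that by auto
    then show ?thesis using ys y that by (cases "j = n") auto
  qed
  then show ?case by blast
qed simp

text \<open>A formula over \<open>M \<union> X\<close> true of the limit \<open>y\<close> is true of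
  some \<open>bs i\<close>, whose entries lie in \<open>M\<close>.\<close>

lemma ind_h_if_limit:
  fixes S :: "('f, 'r, 'm) struct"
  assumes y: "length y = l" "\<And>P. definable S (M \<union> X) l P \<Longrightarrow> P y \<longleftrightarrow> eventually (\<lambda>i. P (bs i)) U"
    and U: "U \<noteq> bot" and bs: "\<And>i. length (bs i) = l" "\<And>i. set (bs i) \<subseteq> M"
  shows "ind_h S (set y) M X"
  unfolding ind_h_def
proof (intro allI impI, elim conjE)
  fix \<phi> as ds
  assume as: "set as \<subseteq> set y" and ds: "set ds \<subseteq> X \<union> M"
    and wf: "wf_fm S (length as + length ds) \<phi>" and h: "holds S (as @ ds) \<phi>"
  have "\<forall>k<length as. \<exists>i<l. y ! i = as ! k" using as y(1) by (metis in_set_conv_nth nth_mem subsetD)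
  then obtain \<rho> where \<rho>: "\<forall>k<length as. \<rho> k < l \<and> y ! \<rho> k = as ! k" by metis
  \<comment> \<open>\<open>as\<close> lists entries of \<open>y\<close> in any order and with
    repetitions; \<open>sel\<close> takes the same positions from another tuple.\<close>
  define sel where "sel = (\<lambda>z :: 'm list. map (\<lambda>k. z ! \<rho> k) [0..<length as])"
  have "sel y = as" unfolding sel_def using \<rho> by (intro nth_equalityI) auto
  moreover have "definable S (M \<union> X) l (\<lambda>z. holds S (sel z @ ds) \<phi>)"
    unfolding sel_def
    by (rule definable_subst[OF definable_formula[OF wf]]) (use ds \<rho> in auto)
  ultimately have "eventually (\<lambda>i. holds S (sel (bs i) @ ds) \<phi>) U"
    using y(2)[of "\<lambda>z. holds S (sel z @ ds) \<phi>"] h by simp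
  then obtain i where i: "holds S (sel (bs i) @ ds) \<phi>" using eventually_happens'[OF U] by blast
  moreover have "set (sel (bs i)) \<subseteq> M"
  proof -
    have "\<forall>k<length as. bs i ! \<rho> k \<in> set (bs i)" using \<rho> bs(1) by simp
    then show ?thesis unfolding sel_def using bs(2)[of i] by auto
  qed
  moreover have "length (sel (bs i)) = length as" by (simp add: sel_def)
  ultimately show "\<exists>cs. set cs \<subseteq> M \<and> length cs = length as \<and> holds S (cs @ ds) \<phi>" by blast
qed

lemma limit_sequence_inconsistent:
  assumes wf: "wf_fm S (n + l) \<phi>" and bs: "\<And>i :: nat. length (bs i) = l" "\<And>i. set (bs i) \<subseteq> M"
    and inc: "\<And>J. \<lbrakk>finite J; card J = k\<rbrakk> \<Longrightarrow>
      \<not> (\<exists>xs. length xs = n \<and> (\<forall>i\<in>J. holds S (xs @ bs i) \<phi>))"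
    and U: "U \<le> sequentially"
    and ys: "\<And>j. j < k \<Longrightarrow> length (ys j) = l"
      "\<And>j P. \<lbrakk>j < k; definable S (M \<union> (\<Union>i<j. set (ys i))) l P\<rbrakk> \<Longrightarrow>
        P (ys j) \<longleftrightarrow> eventually (\<lambda>i. P (bs i)) U"
  shows "\<not> (\<exists>xs. length xs = n \<and> (\<forall>i<k. holds S (xs @ ys i) \<phi>))"
proof -
  have "\<not> (\<exists>xs. length xs = n \<and> (\<forall>i<j. holds S (xs @ ys i) \<phi>) \<and> (\<forall>i\<in>J. holds S (xs @ bs i) \<phi>))"
    if "j \<le> k" "finite J" "card J = k - j" for j J
    \<comment> \<open>The \<open>bs i\<close> are exchanged for the \<open>ys j\<close> one at a time: all but the finitely many \<open>i \<in> J\<close> may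
      take the place of \<open>ys j\<close>, hence almost all \<open>i\<close> with respect to the nonprincipal \<open>U\<close>.\<close>
    using that
  proof (induction j arbitrary: J)
    case 0
    then show ?case using inc[of J] by auto
  next
    case (Suc j)
    let ?X = "M \<union> (\<Union>i<j. set (ys i))"
    define c where "c = (\<lambda>y xs. (\<forall>i<j. holds S (xs @ ys i) \<phi>) \<and> (\<forall>i\<in>J. holds S (xs @ bs i) \<phi>) \<and>
        holds S (xs @ y) \<phi>)"
    \<comment> \<open>\<open>Q y\<close> says that \<open>y\<close> is a suitable next term. It is
      definable over \<open>?X\<close>, so \<open>ys j\<close> satisfies it once
      \<open>U\<close>-almost all \<open>bs i\<close> do.\<close>
    define Q where "Q = (\<lambda>y. \<not> (\<exists>xs. length xs = n \<and> c y xs))"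
    have "Q (bs i)" if "i \<notin> J" for i
    proof -
      \<comment> \<open>With \<open>i\<close> added, \<open>J\<close> has \<open>k - j\<close>
        elements, which is the case \<open>j\<close> of the induction.\<close>
      have "\<not> (\<exists>xs. length xs = n \<and> (\<forall>i<j. holds S (xs @ ys i) \<phi>) \<and>
          (\<forall>i'\<in>insert i J. holds S (xs @ bs i') \<phi>))"
        by (rule Suc.IH) (use Suc.prems that in auto)
      then show ?thesis unfolding Q_def c_def by auto
    qed
    moreover have "eventually (\<lambda>i. i \<notin> J) sequentially"
    proof -
      have "\<forall>i\<ge>Suc (Max (insert 0 J)). i \<notin> J"
      proof (intro allI impI notI)
        fix i assume "Suc (Max (insert 0 J)) \<le> i" "i \<in> J"
        moreover from this have "i \<le> Max (insert 0 J)" using Suc.prems(2) by simp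
        ultimately show False by simp
      qed
      then show ?thesis unfolding eventually_sequentially by blast
    qed
    then have "eventually (\<lambda>i. i \<notin> J) U" using U unfolding le_filter_def by blast
    ultimately have ev: "eventually (\<lambda>i. Q (bs i)) U" by (rule eventually_mono[rotated])
    have atom: "definable S ?X (n + l) (\<lambda>z. holds S (take n z @ e) \<phi>)"
      if "set e \<subseteq> ?X" "length e = l" for e
      by (rule definable_take[OF definable_formula]) (use that wf in auto)
    \<comment> \<open>\<open>z\<close> stands for \<open>xs @ y\<close>: \<open>take n z\<close> is
      \<open>xs\<close>, and \<open>z @ []\<close> gives \<open>\<phi>(xs, y)\<close>. Quantifying
      out the first \<open>n\<close> coordinates leaves a condition on \<open>y\<close>.\<close>
    have "definable S ?X (n + l) (\<lambda>z. (\<forall>i\<in>{..<j}. holds S (take n z @ ys i) \<phi>) \<and>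
        ((\<forall>i\<in>J. holds S (take n z @ bs i) \<phi>) \<and> holds S (z @ []) \<phi>))"
    proof (intro definable_conj definable_Ball)
      show "definable S ?X (n + l) (\<lambda>z. holds S (take n z @ ys i) \<phi>)" if "i \<in> {..<j}" for i
        using that Suc.prems(1) ys(1) by (intro atom) auto
      show "definable S ?X (n + l) (\<lambda>z. holds S (take n z @ bs i) \<phi>)" if "i \<in> J" for i
        using bs by (intro atom) auto
      show "definable S ?X (n + l) (\<lambda>z. holds S (z @ []) \<phi>)"
        by (rule definable_formula) (use wf in auto)
    qed (use Suc.prems(2) in auto)
    from definable_not[OF definable_Ex_list[OF this]]
    have "definable S ?X l Q"
      by (rule definable_cong) (auto simp: Q_def c_def)
    then have "Q (ys j)" using ys(2)[of j Q] Suc.prems(1) ev by simp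
    then show ?case unfolding Q_def c_def by (auto simp: less_Suc_eq)
  qed
  \<comment> \<open>At \<open>j = k\<close> no \<open>bs i\<close> is left.\<close>
  from this[of k "{}"] show ?thesis by auto
qed

text \<open>The arbitrary sequence of \<open>fm_divides\<close> is exchanged for \<open>k\<close>
  terms, each a coheir over \<open>M\<close> relative to the earlier ones. \<open>M\<close> contains
  all \<open>bs i\<close>, so the limit type is finitely satisfiable in it.\<close>

lemma dividing_coheir_sequence:
  fixes S :: "('f, 'r, 'm) struct"
  assumes mon: "monster S \<kappa>" and C: "small \<kappa> C" and div: "fm_divides S C n \<phi> b"
  obtains M k and ys :: "nat \<Rightarrow> 'm list" where
    "small_model S \<kappa> M" "C \<subseteq> M" "0 < k" "list_tp_eq S C b (ys 0)"
    "\<forall>j<k. list_tp_eq S M (ys 0) (ys j)"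
    "\<forall>j<k. ind_h S (set (ys j)) M (\<Union>i<j. set (ys i))"
    "\<not> (\<exists>xs. length xs = n \<and> (\<forall>i<k. holds S (xs @ ys i) \<phi>))"
proof -
  obtain bs k where wf: "wf_fm S (n + length b) \<phi>" and bs: "\<And>i :: nat. list_tp_eq S C (bs i) b"
    and inc: "\<And>J. \<lbrakk>finite J; card J = k\<rbrakk> \<Longrightarrow>
      \<not> (\<exists>xs. length xs = n \<and> (\<forall>i\<in>J. holds S (xs @ bs i) \<phi>))"
    using div unfolding fm_divides_def by blast
  have len: "length (bs i) = length b" for i by (rule list_tp_eq_length[OF bs])
  \<comment> \<open>For \<open>k = 0\<close> the empty \<open>J\<close> would be inconsistent, which
    any list of length \<open>n\<close> refutes; thus \<open>ys 0\<close> is among the first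
    \<open>k\<close> terms.\<close>
  have "k \<noteq> 0" using inc[of "{}"] Ex_list_of_length[of n] by auto
  then have k: "0 < k" by simp
  have "small \<kappa> (C \<union> (\<Union>i. set (bs i)))"
    by (rule small_Un[OF mon C small_UN_nat_finite[OF mon]]) simp
  then obtain M where M: "small_model S \<kappa> M" "C \<union> (\<Union>i. set (bs i)) \<subseteq> M"
    by (rule small_model_exists[OF mon])
  then have sM: "small \<kappa> M" and CM: "C \<subseteq> M" and bM: "\<And>i. set (bs i) \<subseteq> M"
    unfolding small_model_def by auto
  \<comment> \<open>Lying below \<open>sequentially\<close> makes the ultrafilter
    nonprincipal.\<close>
  obtain U :: "nat filter" where U: "U \<le> sequentially" "U \<noteq> bot"
    "\<And>P. eventually P U \<or> eventually (\<lambda>x. \<not> P x) U"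
    using ultrafilter_exists[OF sequentially_bot] by blast
  define real where "real = (\<lambda>X y. length y = length b \<and>
    (\<forall>P. definable S X (length b) P \<longrightarrow> (P y \<longleftrightarrow> eventually (\<lambda>i. P (bs i)) U)))"
  have ex: "\<exists>y. real X y" if "small \<kappa> X" for X
    unfolding real_def by (rule limit_type_realized[OF mon that len U(2,3)])
  obtain ys :: "nat \<Rightarrow> 'm list" where ys: "\<forall>j<k. real (M \<union> (\<Union>i<j. set (ys i))) (ys j)"
    using successive_choice[where Q = real and n = k, OF mon sM ex] by blast
  have len_ys: "length (ys j) = length b" if "j < k" for j
    using ys that unfolding real_def by blast
  have lim: "P (ys j) \<longleftrightarrow> eventually (\<lambda>i. P (bs i)) U"
    if "j < k" "definable S (M \<union> (\<Union>i<j. set (ys i))) (length b) P" for j P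
    using ys that unfolding real_def by blast
  have limM: "P (ys j) \<longleftrightarrow> eventually (\<lambda>i. P (bs i)) U"
    if "j < k" "definable S M (length b) P" for j P
    by (rule lim[OF that(1) definable_mono[OF that(2)]]) blast
  show thesis
  proof (rule that[OF M(1) CM k])
    show "list_tp_eq S C b (ys 0)"
    proof (rule list_tp_eqI)
      fix P assume P: "definable S C (length b) P"
      \<comment> \<open>All \<open>bs i\<close> have the type of \<open>b\<close> over
        \<open>C\<close>, so the truth value is constant along the sequence and passes to the
        limit.\<close>
      have "P (bs i) \<longleftrightarrow> P b" for i
        using list_tp_eq_definable[OF bs[of i], of P] P len by simp
      moreover have "P (ys 0) \<longleftrightarrow> eventually (\<lambda>i. P (bs i)) U"
        by (rule limM[OF k definable_mono[OF P CM]])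
      ultimately show "P b \<longleftrightarrow> P (ys 0)" using U(2) by (simp add: eventually_const)
    qed (simp add: len_ys k)
    show "\<forall>j<k. list_tp_eq S M (ys 0) (ys j)"
    proof (intro allI impI list_tp_eqI)
      fix j P assume j: "j < k"
      assume "definable S M (length (ys 0)) P"
      then have "definable S M (length b) P" using len_ys[OF k] by simp
      from limM[OF k this] limM[OF j this] show "P (ys 0) \<longleftrightarrow> P (ys j)" by (rule trans[OF _ sym])
    qed (simp add: len_ys k)
    show "\<forall>j<k. ind_h S (set (ys j)) M (\<Union>i<j. set (ys i))"
      by (intro allI impI ind_h_if_limit[OF len_ys lim U(2) len bM])
    show "\<not> (\<exists>xs. length xs = n \<and> (\<forall>i<k. holds S (xs @ ys i) \<phi>))"
      by (rule limit_sequence_inconsistent[OF wf len bM inc U(1) len_ys lim])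
  qed
qed

section \<open>Amalgamation\<close>

text \<open>Lists are turned into tuples indexed by \<open>'k\<close>, the form used in
  \<open>h_amalgamation\<close>, through an injection \<open>\<iota>\<close> of the naturals; it
  exists because \<open>\<kappa>\<close> is infinite.\<close>

lemma h_amalgamation_list:
  fixes S :: "('f, 'r, 'm) struct" and \<kappa> :: "'k rel"
  assumes mon: "monster S \<kappa>" and amalg: "h_amalgamation S \<kappa> R"
    and "small_model S \<kappa> M" "small \<kappa> A" "small \<kappa> B" and eq: "list_tp_eq S M xs ys"
    and R: "R (set xs) M A" "R (set ys) M B" and "ind_h S A M B"
  obtains zs where "R (set zs) M (A \<union> B)" "list_tp_eq S (M \<union> A) zs xs" "list_tp_eq S (M \<union> B) zs ys"
proof -
  have "\<not> finite (UNIV :: 'k set)"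
    using monster_infinite[OF mon] finite_subset subset_UNIV by blast
  then obtain \<iota> :: "nat \<Rightarrow> 'k" where \<iota>: "inj \<iota>" using infinite_countable_subset by blast
  define n where "n = length xs"
  have lys: "length ys = n" using list_tp_eq_length[OF eq] by (simp add: n_def)
  define I where "I = \<iota> ` {..<n}"
  define enum where "enum = (\<lambda>(ws :: 'm list) i. ws ! inv \<iota> i)"
  have enum: "map (enum ws) (map \<iota> [0..<n]) = ws" "enum ws ` I = set ws" if "length ws = n" for ws
  proof -
    show "map (enum ws) (map \<iota> [0..<n]) = ws"
      unfolding enum_def using that \<iota> by (intro nth_equalityI) auto
    then have "set (map (enum ws) (map \<iota> [0..<n])) = set ws" by (rule arg_cong)
    then show "enum ws ` I = set ws" by (simp add: I_def image_image atLeast0LessThan)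
  qed
  have "tp_eq S M I (enum xs) (enum ys)"
    unfolding tp_eq_def
  proof (intro allI impI)
    fix "is" assume "set is \<subseteq> I"
    then have "set (map (inv \<iota>) is) \<subseteq> {..<length xs}" using \<iota> by (auto simp: I_def n_def)
    then have "list_tp_eq S M (map ((!) xs) (map (inv \<iota>) is)) (map ((!) ys) (map (inv \<iota>) is))"
      using list_tp_eq_imp_tp_eq[OF eq] unfolding tp_eq_def by blast
    then show "list_tp_eq S M (map (enum xs) is) (map (enum ys) is)"
      by (simp add: enum_def comp_def)
  qed
  moreover have "small \<kappa> I" by (rule small_finite[OF mon]) (simp add: I_def)
  ultimately obtain c where c: "R (c ` I) M (A \<union> B)"
    "tp_eq S (M \<union> A) I c (enum xs)" "tp_eq S (M \<union> B) I c (enum ys)"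
    using amalg assms(3-5,9) R enum(2)[of xs] enum(2)[OF lys]
    unfolding h_amalgamation_def n_def by metis
  let ?is = "map \<iota> [0..<n]"
  have "set ?is \<subseteq> I" by (auto simp: I_def)
  then have "list_tp_eq S (M \<union> A) (map c ?is) (map (enum xs) ?is)"
    "list_tp_eq S (M \<union> B) (map c ?is) (map (enum ys) ?is)"
    using c(2,3) unfolding tp_eq_def by blast+
  then have "list_tp_eq S (M \<union> A) (map c ?is) xs" "list_tp_eq S (M \<union> B) (map c ?is) ys"
    unfolding enum(1)[OF lys] enum(1)[OF n_def[symmetric]] .
  moreover have "set (map c ?is) = c ` I" by (simp add: I_def image_image atLeast0LessThan)
  ultimately show thesis using that c(1) by metis
qed

text \<open>An intermediate \<open>D\<close> for the images is pulled back along
  \<open>\<sigma>\<close>; \<open>acl\<close> commutes with automorphisms, so the preimage is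
  intermediate for the original sets.\<close>

lemma ind_M_automorphism:
  assumes mon: "monster S \<kappa>" and inv: "invariant S \<kappa> R" and \<sigma>: "automorphism S \<sigma>"
    and small: "small \<kappa> A" "small \<kappa> B" "small \<kappa> C" and ind: "ind_M S R A C B"
  shows "ind_M S R (\<sigma> ` A) (\<sigma> ` C) (\<sigma> ` B)"
  unfolding ind_M_def
proof (intro allI impI, elim conjE)
  fix D assume D: "\<sigma> ` C \<subseteq> D" "D \<subseteq> acl S (\<sigma> ` B \<union> \<sigma> ` C)"
  have bij: "bij \<sigma>" using \<sigma> unfolding automorphism_def by blast
  define D' where "D' = \<sigma> -` D"
  have im: "\<sigma> ` D' = D" unfolding D'_def using bij by (simp add: bij_def surj_image_vimage_eq)
  have "C \<subseteq> D'" using D(1) unfolding D'_def by blast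
  moreover have "D' \<subseteq> acl S (B \<union> C)"
    using D(2) acl_automorphism[OF \<sigma>, of _ "B \<union> C"] unfolding D'_def image_Un by blast
  ultimately have "R A D' B" using ind unfolding ind_M_def by blast
  moreover have "small \<kappa> D'"
    using small_subset[OF small_acl[OF mon small_Un[OF mon small(2,3)]] \<open>D' \<subseteq> acl S (B \<union> C)\<close>] .
  moreover have "realizes S {} (A \<union> B \<union> D') \<sigma>" by (rule automorphism_realizes[OF \<sigma>]) simp
  ultimately show "R (\<sigma> ` A) D (\<sigma> ` B)"
    using inv small(1,2) im unfolding invariant_def by metis
qed

text \<open>Keeping \<open>c\<close> in the type of \<open>a\<close> over \<open>M\<close> makes it
  equivalent to the conjugate of \<open>a\<close> that satisfies the formula at \<open>ys m\<close>;
  the coheir condition then lets the two be amalgamated.\<close>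

lemma coheir_sequence_consistent:
  fixes S :: "('f, 'r, 'm) struct" and ys :: "nat \<Rightarrow> 'm list"
  assumes mon: "monster S \<kappa>" and inv: "invariant S \<kappa> R" and right: "right_monotone \<kappa> R"
    and amalg: "h_amalgamation S \<kappa> R" and M: "small_model S \<kappa> M"
    and ys: "\<And>j. j < k \<Longrightarrow> list_tp_eq S M (ys 0) (ys j)"
      "\<And>j. j < k \<Longrightarrow> ind_h S (set (ys j)) M (\<Union>i<j. set (ys i))"
    and R: "R (set a) M (set (ys 0))"
    and wf: "wf_fm S (length a + length (ys 0)) \<phi>" and h: "holds S (a @ ys 0) \<phi>"
    and "m \<le> k"
  shows "\<exists>c. list_tp_eq S M a c \<and> R (set c) M (\<Union>i<m. set (ys i)) \<and> (\<forall>i<m. holds S (c @ ys i) \<phi>)"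
proof -
  have sM: "small \<kappa> M" using M unfolding small_model_def by blast
  have fin: "small \<kappa> X" if "finite X" for X :: "'m set" by (rule small_finite[OF mon that])
  show ?thesis
    using \<open>m \<le> k\<close>
  proof (induction m)
    case 0
    have "R (set a) M {}"
    proof -
      \<comment> \<open>Right monotonicity shrinks the right-hand side to the empty union of the
        case \<open>m = 0\<close>.\<close>
      have "R (set a) M ({} \<union> set (ys 0))" using R by simp
      then show ?thesis using right sM fin unfolding right_monotone_def by (metis finite.emptyI List.finite_set)
    qed
    then show ?case using list_tp_eq_refl[of S M a] by auto
  next
    case (Suc m)
    let ?X = "\<Union>i<m. set (ys i)"
    obtain c where c: "list_tp_eq S M a c" "R (set c) M ?X" "\<forall>i<m. holds S (c @ ys i) \<phi>"
      using Suc by auto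
    have m: "m < k" using Suc.prems by simp
    obtain \<sigma> where \<sigma>: "automorphism S \<sigma>" "\<forall>x\<in>M. \<sigma> x = x" "map \<sigma> (ys 0) = ys m"
      by (rule list_tp_eq_automorphism[OF mon sM ys(1)[OF m]])
    \<comment> \<open>\<open>?a\<close> stands to \<open>ys m\<close> as \<open>a\<close> stands to
      \<open>ys 0\<close>.\<close>
    let ?a = "map \<sigma> a"
    have "R (\<sigma> ` set a) (\<sigma> ` M) (\<sigma> ` set (ys 0))"
    proof -
      have "realizes S {} (set a \<union> set (ys 0) \<union> M) \<sigma>" by (rule automorphism_realizes[OF \<sigma>(1)]) simp
      then show ?thesis using inv R sM fin unfolding invariant_def by blast
    qed
    moreover have "\<sigma> ` M = M" using \<sigma>(2) by simp
    moreover have "\<sigma> ` set (ys 0) = set (ys m)" using \<sigma>(3) by (metis list.set_map)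
    ultimately have "R (set ?a) M (set (ys m))" by simp
    moreover have "list_tp_eq S M ?a c"
      by (rule list_tp_eq_trans[OF list_tp_eq_sym[OF automorphism_list_tp_eq[OF \<sigma>(1,2)]] c(1)])
    moreover have "small \<kappa> (set (ys m))" "small \<kappa> ?X" by (auto intro: fin)
    \<comment> \<open>The new term \<open>ys m\<close> is the left side of the coheir condition and
      the earlier terms \<open>?X\<close> are the right side.\<close>
    ultimately obtain c' where c': "R (set c') M (set (ys m) \<union> ?X)"
      "list_tp_eq S (M \<union> set (ys m)) c' ?a" "list_tp_eq S (M \<union> ?X) c' c"
      using h_amalgamation_list[OF mon amalg M _ _ _ _ c(2) ys(2)[OF m]] by metis
    have "list_tp_eq S M a c'"
      by (rule list_tp_eq_trans[OF c(1) list_tp_eq_sym[OF list_tp_eq_mono[OF c'(3)]]]) blast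
    moreover have "set (ys m) \<union> ?X = (\<Union>i<Suc m. set (ys i))" by (auto simp: less_Suc_eq)
    then have "R (set c') M (\<Union>i<Suc m. set (ys i))" using c'(1) by simp
    moreover have "holds S (c' @ ys i) \<phi>" if "i < Suc m" for i
    proof (cases "i = m")
      case True
      have "holds S (?a @ ys m) \<phi>"
        using holds_automorphism[OF \<sigma>(1), of "a @ ys 0" \<phi>] h wf \<sigma>(3) by simp
      moreover have "wf_fm S (length c' + length (ys m)) \<phi>"
        using wf list_tp_eq_length[OF c'(2)] list_tp_eq_length[OF ys(1)[OF m]] by simp
      ultimately show ?thesis using c'(2) True unfolding list_tp_eq_def by blast
    next
      case False
      then have i: "i < m" using that by simp
      then have "set (ys i) \<subseteq> M \<union> ?X" by blast
      moreover have "wf_fm S (length c' + length (ys i)) \<phi>"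
        using wf list_tp_eq_length[OF c'(2)] list_tp_eq_length[OF ys(1)[of i]] i m by simp
      ultimately show ?thesis using c'(3) c(3) i unfolding list_tp_eq_def by blast
    qed
    ultimately show ?case by blast
  qed
qed

lemma not_fm_divides_if_ind_M:
  fixes S :: "('f, 'r, 'm) struct" and \<kappa> :: "'k rel"
  assumes mon: "monster S \<kappa>" and inv: "invariant S \<kappa> R"
    and left: "left_monotone \<kappa> R" and right: "right_monotone \<kappa> R"
    and amalg: "h_amalgamation S \<kappa> R" and ext: "extension S \<kappa> (ind_M S R)"
    and small: "small \<kappa> A" "small \<kappa> B" "small \<kappa> C"
    and ind: "ind_M S R A C B" and as: "set as \<subseteq> A" and b: "set b \<subseteq> B"
    and h: "holds S (as @ b) \<phi>"
  shows "\<not> fm_divides S C (length as) \<phi> b"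
proof
  assume div: "fm_divides S C (length as) \<phi> b"
  have wf: "wf_fm S (length as + length b) \<phi>" using div unfolding fm_divides_def by blast
  obtain M k and ys :: "nat \<Rightarrow> 'm list" where M: "small_model S \<kappa> M" "C \<subseteq> M"
    and k: "0 < k" and b_ys: "list_tp_eq S C b (ys 0)"
    and ys: "\<forall>j<k. list_tp_eq S M (ys 0) (ys j)"
      "\<forall>j<k. ind_h S (set (ys j)) M (\<Union>i<j. set (ys i))"
    and inc: "\<not> (\<exists>xs. length xs = length as \<and> (\<forall>i<k. holds S (xs @ ys i) \<phi>))"
    by (rule dividing_coheir_sequence[OF mon small(3) div])
  have sM: "small \<kappa> M" using M(1) unfolding small_model_def by blast
  \<comment> \<open>\<open>\<tau>\<close> brings \<open>b\<close> to the first term of the sequence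
    and fixes \<open>C\<close>, so independence over \<open>C\<close> is kept.\<close>
  obtain \<tau> where \<tau>: "automorphism S \<tau>" "\<forall>c\<in>C. \<tau> c = c" "map \<tau> b = ys 0"
    by (rule list_tp_eq_automorphism[OF mon small(3) b_ys])
  let ?A = "\<tau> ` A" and ?B = "\<tau> ` B"
  have sA: "small \<kappa> ?A" and sB: "small \<kappa> ?B" using small by (auto intro: small_image)
  have "\<tau> ` C = C" using \<tau>(2) by simp
  then have "ind_M S R ?A C ?B" using ind_M_automorphism[OF mon inv \<tau>(1) small ind] by simp
  moreover have sBM: "small \<kappa> (?B \<union> M)" by (rule small_Un[OF mon sB sM])
  \<comment> \<open>Extension puts \<open>M\<close> on the right. The copy under \<open>g\<close>
    has the same type over the moved \<open>B\<close> and over \<open>C\<close>, so the formula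
    still holds at \<open>ys 0\<close>.\<close>
  ultimately obtain g where g: "realizes S (?B \<union> C) ?A g" "ind_M S R (g ` ?A) C (?B \<union> M)"
    using ext sA sB small(3) unfolding extension_def by (meson Un_upper1)
  define a where "a = map g (map \<tau> as)"
  have ysB: "set (ys 0) \<subseteq> ?B" using b \<tau>(3) by (metis image_mono list.set_map)
  have asA: "set (map \<tau> as) \<subseteq> ?A" using as by auto
  have wf0: "wf_fm S (length (map \<tau> as) + length (ys 0)) \<phi>"
    using wf \<tau>(3) by (metis length_map)
  have "holds S (map \<tau> as @ ys 0) \<phi>"
    using holds_automorphism[OF \<tau>(1), of "as @ b" \<phi>] wf h \<tau>(3) by simp
  then have ha: "holds S (a @ ys 0) \<phi>"
    using tp_eq_holds[OF g(1) asA _ wf0] ysB unfolding a_def by auto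
  \<comment> \<open>\<open>ind_M\<close> admits every base between \<open>C\<close> and the closure,
    hence \<open>M\<close> itself once it lies on the right; this is how the base passes from
    \<open>C\<close> to \<open>M\<close>.\<close>
  have "M \<subseteq> acl S (?B \<union> M \<union> C)"
    using subset_acl[of "?B \<union> M \<union> C" S] by blast
  then have "R (g ` ?A) M (?B \<union> M)" using g(2) M(2) unfolding ind_M_def by blast
  then have "R (g ` ?A) M (set (ys 0))"
    using right sM sBM small_image[OF sA, of g] small_finite[OF mon, of "set (ys 0)"] ysB
    unfolding right_monotone_def by (metis List.finite_set le_supI1 sup.absorb2)
  moreover have "set a \<subseteq> g ` ?A" using asA by (auto simp: a_def)
  ultimately have "R (set a) M (set (ys 0))"
    using left sM small_image[OF sA, of g] small_finite[OF mon, of "set (ys 0)"]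
      small_finite[OF mon, of "set a"]
    unfolding left_monotone_def by (metis List.finite_set sup.absorb2)
  then obtain c where c: "list_tp_eq S M a c" "\<forall>i<k. holds S (c @ ys i) \<phi>"
    using coheir_sequence_consistent[where a = a and m = k and \<phi> = \<phi>,
        OF mon inv right amalg M(1) ys[rule_format]] wf0 ha
    by (auto simp: a_def)
  have "length c = length as" using list_tp_eq_length[OF c(1)] by (simp add: a_def)
  then show False using inc c(2) by blast
qed

text \<open>Extension adds the parameters of all the dividing formulas to the right side. The new
  realization satisfies one of these formulas, which \<open>not_fm_divides_if_ind_M\<close>
  forbids.\<close>

lemma ind_f_if_ind_M:
  assumes mon: "monster S \<kappa>" and "invariant S \<kappa> R" "left_monotone \<kappa> R" "right_monotone \<kappa> R"
    "h_amalgamation S \<kappa> R" and ext: "extension S \<kappa> (ind_M S R)"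
    and small: "small \<kappa> A" "small \<kappa> B" "small \<kappa> C" and ind: "ind_M S R A C B"
  shows "ind_f S A C B"
  unfolding ind_f_def
proof
  assume "tp_forks S A (B \<union> C) C"
  then obtain \<Phi> where \<Phi>: "finite \<Phi>"
    "\<forall>(as, \<phi>, b) \<in> \<Phi>. set as \<subseteq> A \<and> fm_divides S C (length as) \<phi> b"
    "\<And>f. realizes S (B \<union> C) A f \<Longrightarrow> \<exists>(as, \<phi>, b) \<in> \<Phi>. holds S (map f as @ b) \<phi>"
    unfolding tp_forks_def by blast
  define D where "D = B \<union> (\<Union>(as, \<phi>, b)\<in>\<Phi>. set b)"
  have "finite (\<Union>(as, \<phi>, b)\<in>\<Phi>. set b)" using \<Phi>(1) by auto
  then have sD: "small \<kappa> D" unfolding D_def by (intro small_Un[OF mon small(2)] small_finite[OF mon])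
  moreover have "B \<subseteq> D" by (simp add: D_def)
  ultimately obtain f where f: "realizes S (B \<union> C) A f" "ind_M S R (f ` A) C D"
    using ext small ind unfolding extension_def by meson
  then obtain as \<phi> b where *: "(as, \<phi>, b) \<in> \<Phi>" "holds S (map f as @ b) \<phi>" using \<Phi>(3) by blast
  have "set as \<subseteq> A" "fm_divides S C (length (map f as)) \<phi> b" using \<Phi>(2) * by auto
  then have "set (map f as) \<subseteq> f ` A" unfolding set_map by (intro image_mono)
  moreover have "set b \<subseteq> D" using * by (auto simp: D_def)
  ultimately show False
    using \<open>fm_divides S C (length (map f as)) \<phi> b\<close>
      not_fm_divides_if_ind_M[OF assms(1-6) small_image[OF small(1)] sD small(3) f(2) _ _ *(2)]
    by blast
qed

theorem mainTheorem2:
  fixes S :: "('f, 'r, 'm) struct"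
    and \<kappa> :: "'k rel"
    and R :: "'m ternary"
  assumes "monster S \<kappa>"
    and "invariant S \<kappa> R"
    and "left_monotone \<kappa> R"
    and "right_monotone \<kappa> R"
    and "rel_implies \<kappa> (ind_da S) R"
    and "h_amalgamation S \<kappa> R"
    and "extension S \<kappa> (ind_M S R)"
  shows "\<forall>A B C. small \<kappa> A \<and> small \<kappa> B \<and> small \<kappa> C \<longrightarrow>
           (ind_M S R A C B \<longleftrightarrow> ind_f S A C B) \<and> (ind_f S A C B \<longleftrightarrow> ind_da S A C B)"
proof (intro allI impI, elim conjE)
  fix A B C :: "'m set"
  assume small: "small \<kappa> A" "small \<kappa> B" "small \<kappa> C"
  have "ind_M S R A C B \<Longrightarrow> ind_f S A C B" by (rule ind_f_if_ind_M[OF assms(1-4,6,7) small])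
  moreover have "ind_f S A C B \<Longrightarrow> ind_da S A C B" by (rule ind_da_if_ind_f[OF assms(1) small])
  moreover have "ind_da S A C B \<Longrightarrow> ind_M S R A C B" by (rule ind_M_if_ind_da[OF assms(1,5) small])
  ultimately show "(ind_M S R A C B \<longleftrightarrow> ind_f S A C B) \<and> (ind_f S A C B \<longleftrightarrow> ind_da S A C B)" by blast
qed

end
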